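(* Let $g_0\in G$ and let $\lambda$ be a Borel probability measure on $\mathcal X$ that is admissible with respect to $\varphi^{g_0}_t$. Let $\mathcal A_1,\dots,\mathcal A_r\subset\mathbb R^k$ be bounded Borel sets with $\mathrm{vol}_{\mathbb R^k}(\partial\mathcal A_i)=0$ and $N\in\mathbb Z_{\ge0}^r$. Then $$\lim_{L\to\infty}\lambda\big(\{x:\#\{j:L^{-n/k}\xi^{g_0}_j(x,L)\in\mathcal A_i\}=N_i\ \forall i\}\big)=\mu\big(\{\Gamma g:\#(\widehat{\mathbb Z}^ng\cap\mathcal C(\mathcal A_i,\mathcal W))=N_i\ \forall i\}\big).$$ In particular, for every $X>0$, $\lim_{L\to\infty}\lambda(\{x:L^{-n/k}|\xi^{g_0}_1(x,L)|>X\})=\mu(\{\Gamma g:\widehat{\mathbb Z}^ng\cap\mathcal C(B^k_X,\mathcal W)=\emptyset\})$.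
   Context: Fix integers $k\ge1$, $m\ge0$, $n=k+m+1$; $G=\mathrm{SL}(n,\mathbb R)$, $\Gamma=\mathrm{SL}(n,\mathbb Z)$, $\mathcal X=\Gamma\backslash G$, $\mu$ the right-$G$-invariant probability measure on $\mathcal X$. Row vectors $y=(y',y'',y_n)\in\mathbb R^k\times\mathbb R^m\times\mathbb R$, right action; $\widehat{\mathbb Z}^n$ primitive integer vectors. $U(s)=\begin{pmatrix}1_k&0&0\\0&1_m&0\\-s&0&1\end{pmatrix}$ ($s\in\mathbb R^k$, middle block absent if $m=0$); $\Phi(t)=\mathrm{diag}(e^{(m+1)t}1_k,e^{-kt}1_m,e^{-kt})$. For $g_0\in G$: $h^{g_0}_s(x)=xg_0U(s)g_0^{-1}$, $\varphi^{g_0}_t(x)=xg_0\Phi(t)g_0^{-1}$; $\lambda$ is admissible with respect to $\varphi^{g_0}_t$ if $\lim_{t\to\infty}\lambda(\varphi^{g_0}_tE)=\mu(E)$ for every Borel $E\subset\mathcal X$ with $\mu(\partial E)=0$. Fix a norm $|\cdot|$ on $\mathbb R^k$, $B^k_X$ its closed balls. Let $\mathcal W\subset\mathbb R^m\times\mathbb R_{>0}$ be bounded Borel with non-empty interior and Lebesgue-null boundary; $\mathcal C(\mathcal A,\mathcal W)=\{y:y'\in y_n\mathcal A,(y'',y_n)\in\mathcal W\}$. For $x=\Gamma g$, $L>0$, the hitting times $\xi_1(x,L),\xi_2(x,L),\dots$ list with multiplicity the multiset $\{v'/v_n:v\in\widehat{\mathbb Z}^ng,(v'',v_n)\in L^{-1}\mathcal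 W\}$ ordered by nondecreasing $|\cdot|$ (the times the orbit $xU(s)$ meets the section $\Gamma\backslash\Gamma H\{R(w):w\in L^{-1}\mathcal W\}$); and $\xi^{g_0}_j(x,L):=\xi_j(xg_0,L)$ are the hitting times of $h^{g_0}_s(x)$ with the conjugated section (its image under right multiplication by $g_0^{-1}$). $|\xi^{g_0}_1|=\infty$ if none exists. *)

theory Defs
  imports "HOL-Probability.Probability"
begin

text \<open>Coordinates of R^n are indexed by the type ('k + 'j): the first block
  (indices Inl i) is R^k, the second block (indices Inr j) is R^(m+1) = R^m x R,
  where the distinguished index jn :: 'j plays the role of the last coordinate y_n.
  Thus k = CARD('k), m = CARD('j) - 1, n = CARD('k) + CARD('j).
  Row vectors act on the right: v v* g.\<close>

type_synonym ('k,'j) rvec = "real ^ ('k + 'j)"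
type_synonym ('k,'j) rmat = "real ^ ('k + 'j) ^ ('k + 'j)"

definition ypr :: "('k::finite,'j::finite) rvec \<Rightarrow> real ^ 'k" where
  "ypr y = (\<chi> i. y $ Inl i)"

definition yjn :: "('k::finite,'j::finite) rvec \<Rightarrow> real ^ 'j" where
  "yjn y = (\<chi> j. y $ Inr j)"

definition SLn :: "('k::finite,'j::finite) rmat set" where
  "SLn = {g. det g = 1}"

definition SLnZ :: "('k::finite,'j::finite) rmat set" where
  "SLnZ = {g \<in> SLn. \<forall>a b. g $ a $ b \<in> \<int>}"

text \<open>Borel subsets of the quotient Gamma\G, represented by their (left Gamma-invariant,
  Borel) preimages in G.\<close>
definition Xsets :: "('k::finite,'j::finite) rmat set set" where
  "Xsets = {E. E \<subseteq> SLn \<and> E \<in> sets borel \<and> (\<forall>\<gamma>\<in>SLnZ. \<forall>g\<in>E. \<gamma> ** g \<in> E)}"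

definition Xprob :: "('k::finite,'j::finite) rmat measure \<Rightarrow> bool" where
  "Xprob lam \<longleftrightarrow> prob_space lam \<and> space lam = SLn \<and> sets lam = Xsets"

text \<open>Boundary in X (preimage in G of the boundary of E in Gamma\G).\<close>
definition Xfrontier :: "('k::finite,'j::finite) rmat set \<Rightarrow> ('k,'j) rmat set" where
  "Xfrontier E = (subtopology euclidean SLn) frontier_of E"

definition rtrans :: "('k::finite,'j::finite) rmat set \<Rightarrow> ('k,'j) rmat \<Rightarrow> ('k,'j) rmat set" where
  "rtrans E h = (\<lambda>g. g ** h) ` E"

definition Haar_X :: "('k::finite,'j::finite) rmat measure \<Rightarrow> bool" where
  "Haar_X mu \<longleftrightarrow> Xprob mu \<and>
     (\<forall>h\<in>SLn. \<forall>E\<in>Xsets. emeasure mu (rtrans E h) = emeasure mu E)"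

definition Phi :: "real \<Rightarrow> ('k::finite,'j::finite) rmat" where
  "Phi t = (\<chi> a b. if a = b then
       (case a of Inl _ \<Rightarrow> exp (real CARD('j) * t) | Inr _ \<Rightarrow> exp (- real CARD('k) * t))
     else 0)"

text \<open>The flow phi^{g0}_t acts on X by right multiplication with g0 Phi(t) g0^{-1}.\<close>
definition phi_conj :: "('k::finite,'j::finite) rmat \<Rightarrow> real \<Rightarrow> ('k,'j) rmat" where
  "phi_conj g0 t = g0 ** Phi t ** matrix_inv g0"

definition admissible :: "('k::finite,'j::finite) rmat measure \<Rightarrow> ('k,'j) rmat measure
     \<Rightarrow> ('k,'j) rmat \<Rightarrow> bool" where
  "admissible mu lam g0 \<longleftrightarrow>
     (\<forall>E\<in>Xsets. emeasure mu (Xfrontier E) = 0 \<longrightarrow>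
        ((\<lambda>t. measure lam (rtrans E (phi_conj g0 t))) \<longlongrightarrow> measure mu E) at_top)"

definition int_vec :: "('k::finite,'j::finite) rvec \<Rightarrow> bool" where
  "int_vec v \<longleftrightarrow> (\<forall>a. v $ a \<in> \<int>)"

definition primitive :: "('k::finite,'j::finite) rvec \<Rightarrow> bool" where
  "primitive v \<longleftrightarrow> int_vec v \<and> v \<noteq> 0 \<and>
     (\<forall>(d::int) w. int_vec w \<and> v = of_int d *\<^sub>R w \<longrightarrow> \<bar>d\<bar> = 1)"

definition primlat :: "('k::finite,'j::finite) rmat \<Rightarrow> ('k,'j) rvec set" where
  "primlat g = {w v* g | w. primitive w}"

definition cone :: "'j \<Rightarrow> (real ^ 'k) set \<Rightarrow> (real ^ 'j) set \<Rightarrow> ('k::finite,'j::finite) rvec set" where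
  "cone jn A W = {y. ypr y \<in> (\<lambda>a. (y $ Inr jn) *\<^sub>R a) ` A \<and> yjn y \<in> W}"

text \<open>The hitting times at level L (with multiplicity) are the points v'/v_n for v in
  Zhat^n g with (v'',v_n) \<in> L^{-1} W, one for each such v.  hit_count counts, with
  multiplicity, the indices j with L^{-n/k} xi_j(Gamma g, L) \<in> A.\<close>
definition hit_set :: "'j \<Rightarrow> (real ^ 'j) set \<Rightarrow> ('k::finite,'j::finite) rmat \<Rightarrow> real
     \<Rightarrow> ('k,'j) rvec set" where
  "hit_set jn W g L = {v \<in> primlat g. yjn v \<in> (\<lambda>w. inverse L *\<^sub>R w) ` W}"

definition hit_time :: "'j \<Rightarrow> ('k::finite,'j::finite) rvec \<Rightarrow> real ^ 'k" where
  "hit_time jn v = inverse (v $ Inr jn) *\<^sub>R ypr v"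

definition hit_count :: "'j \<Rightarrow> (real ^ 'j) set \<Rightarrow> ('k::finite,'j::finite) rmat \<Rightarrow> real
     \<Rightarrow> (real ^ 'k) set \<Rightarrow> nat" where
  "hit_count jn W g L A =
     card {v \<in> hit_set jn W g L.
             (L powr (- real (CARD('k) + CARD('j)) / real CARD('k))) *\<^sub>R hit_time jn v \<in> A}"

text \<open>|xi_1(Gamma g, L)| w.r.t. the norm nrm; infinity if there is no hitting time.\<close>
definition xi1_norm :: "(real ^ 'k \<Rightarrow> real) \<Rightarrow> 'j \<Rightarrow> (real ^ 'j) set
     \<Rightarrow> ('k::finite,'j::finite) rmat \<Rightarrow> real \<Rightarrow> ereal" where
  "xi1_norm nrm jn W g L = Inf ((\<lambda>v. ereal (nrm (hit_time jn v))) ` hit_set jn W g L)"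

definition is_norm :: "(real ^ 'k::finite \<Rightarrow> real) \<Rightarrow> bool" where
  "is_norm nrm \<longleftrightarrow> (\<forall>x. nrm x = 0 \<longleftrightarrow> x = 0) \<and> (\<forall>c x. nrm (c *\<^sub>R x) = \<bar>c\<bar> * nrm x)
     \<and> (\<forall>x y. nrm (x + y) \<le> nrm x + nrm y)"

end

theory Submission
  imports Defs
begin

text \<open>
  With \<open>L = exp (k t)\<close>, right multiplication by \<open>Phi (- t)\<close> carries the hitting vectors at level \<open>L\<close>
  with rescaled hitting time in \<open>A\<close> onto the primitive lattice vectors in \<open>cone jn A W\<close>. The event
  at level \<open>L\<close> is therefore the translate by \<open>phi_conj g0 t\<close> of a fixed set, and admissibility
  gives the limit once the frontier of that set is \<open>mu\<close>-null. The number of lattice points in a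
  bounded set is locally constant away from lattices that meet its frontier, and the frontier
  of the cone is Lebesgue null, so it remains to see that \<open>mu\<close>-almost no lattice has a primitive vector in a
  given Lebesgue null set \<open>F\<close>. For this \<open>mu\<close> is lifted to a sigma-finite right-invariant
  measure on matrices, and Fubini is applied to translates by a family \<open>h s\<close> in SL(n,R) for which
  \<open>s \<mapsto> v h(s)\<close> pulls null sets back to null sets.
\<close>

section \<open>Matrices and primitive lattice vectors\<close>

lemma bounded_bilinear_vector_matrix_mult:
  "bounded_bilinear (\<lambda>(v::real^'n::finite) (g::real^'m::finite^'n). v v* g)"
  unfolding bilinear_conv_bounded_bilinear[symmetric] bilinear_def
  by (auto intro!: linearI simp: algebra_simps vector_scaleR_matrix_ac scaleR_vector_matrix_assoc)

lemma bounded_bilinear_matrix_matrix_mult: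
  "bounded_bilinear (\<lambda>(g::real^'n::finite^'m::finite) (h::real^'l::finite^'n). g ** h)"
  unfolding bilinear_conv_bounded_bilinear[symmetric] bilinear_def
  by (auto intro!: linearI simp: matrix_matrix_mult_def vec_eq_iff algebra_simps sum.distrib
      sum_distrib_left)

lemmas continuous_on_vector_matrix_mult [continuous_intros] =
  bounded_bilinear.continuous_on[OF bounded_bilinear_vector_matrix_mult]

lemmas continuous_on_matrix_matrix_mult [continuous_intros] =
  bounded_bilinear.continuous_on[OF bounded_bilinear_matrix_matrix_mult]

lemma borel_measurable_matrix_matrix_mult [measurable]:
  fixes f :: "'a \<Rightarrow> real^'n::finite^'m::finite" and g :: "'a \<Rightarrow> real^'l::finite^'n"
  assumes "f \<in> borel_measurable M" "g \<in> borel_measurable M"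
  shows "(\<lambda>x. f x ** g x) \<in> borel_measurable M"
  by (rule borel_measurable_continuous_Pair[OF assms])
     (intro continuous_on_matrix_matrix_mult continuous_on_fst continuous_on_snd continuous_on_id)

lemma borel_measurable_vector_matrix_mult [measurable]:
  fixes f :: "'a \<Rightarrow> real^'n::finite" and g :: "'a \<Rightarrow> real^'l::finite^'n"
  assumes "f \<in> borel_measurable M" "g \<in> borel_measurable M"
  shows "(\<lambda>x. f x v* g x) \<in> borel_measurable M"
  by (rule borel_measurable_continuous_Pair[OF assms])
     (intro continuous_on_vector_matrix_mult continuous_on_fst continuous_on_snd continuous_on_id)

lemma continuous_on_det [continuous_intros]:
  fixes f :: "'a::topological_space \<Rightarrow> real^'n::finite^'n"
  assumes "continuous_on S f"
  shows "continuous_on S (\<lambda>x. det (f x))"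
  unfolding det_def by (intro continuous_intros assms)

lemma SLn_borel [measurable]: "SLn \<in> sets borel"
proof -
  have "closed (SLn :: ('k::finite,'j::finite) rmat set)"
    unfolding SLn_def by (intro closed_Collect_eq continuous_intros)
  then show ?thesis by (rule borel_closed)
qed

lemma SLn_mult: "g \<in> SLn \<Longrightarrow> h \<in> SLn \<Longrightarrow> g ** h \<in> SLn"
  by (simp add: SLn_def det_mul)

lemma SLn_one: "mat 1 \<in> SLn"
  by (simp add: SLn_def)

lemma SLn_inverse:
  assumes "g \<in> SLn"
  shows "g ** matrix_inv g = mat 1" "matrix_inv g ** g = mat 1" "matrix_inv g \<in> SLn"
proof -
  have "invertible g" using assms by (simp add: invertible_det_nz SLn_def)
  then have "\<exists>h. g ** h = mat 1 \<and> h ** g = mat 1" by (simp add: invertible_def)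
  then have "g ** matrix_inv g = mat 1 \<and> matrix_inv g ** g = mat 1"
    unfolding matrix_inv_def by (rule someI_ex)
  then show i: "g ** matrix_inv g = mat 1" "matrix_inv g ** g = mat 1" by auto
  have "det g * det (matrix_inv g) = 1" using i(1) det_mul[of g "matrix_inv g"] by simp
  then show "matrix_inv g \<in> SLn" using assms by (simp add: SLn_def)
qed

lemma SLn_cancel_right:
  assumes "g \<in> SLn"
  shows "x ** g ** matrix_inv g = x" "x ** matrix_inv g ** g = x"
  by (simp_all add: SLn_inverse[OF assms] flip: matrix_mul_assoc)

lemma SLn_vec_cancel:
  assumes "g \<in> SLn"
  shows "v v* g v* matrix_inv g = v" "v v* matrix_inv g v* g = v"
  by (simp_all add: SLn_inverse[OF assms] vector_matrix_mul_assoc)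

lemma SLn_vec_inj:
  assumes "g \<in> SLn"
  shows "v v* g = w v* g \<longleftrightarrow> v = w"
  by (metis SLn_vec_cancel(1)[OF assms])

lemma SLn_vec_eq_0: "g \<in> SLn \<Longrightarrow> v v* g = 0 \<longleftrightarrow> v = 0"
  using SLn_vec_inj[of g v 0] by simp

lemma SLnZ_subset: "g \<in> SLnZ \<Longrightarrow> g \<in> SLn"
  by (simp add: SLnZ_def)

lemma SLnZ_one: "mat 1 \<in> SLnZ"
  using SLn_one by (auto simp: SLnZ_def mat_def)

lemma SLnZ_mult: "g \<in> SLnZ \<Longrightarrow> h \<in> SLnZ \<Longrightarrow> g ** h \<in> SLnZ"
  using SLn_mult[of g h]
  by (auto simp: SLnZ_def matrix_matrix_mult_def intro!: Ints_sum Ints_mult)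

lemma det_Ints:
  fixes M :: "real^'n::finite^'n"
  assumes "\<And>i j. M $ i $ j \<in> \<int>"
  shows "det M \<in> \<int>"
  unfolding det_def by (intro Ints_sum Ints_mult Ints_prod assms) auto

text \<open>Cramer's rule: column \<open>b\<close> of the inverse solves
  \<open>g *v x = axis b 1\<close>, so its entries are determinants of integer matrices divided by
  \<open>det g = 1\<close>.\<close>

lemma SLnZ_inverse:
  assumes "g \<in> SLnZ"
  shows "matrix_inv g \<in> SLnZ"
proof -
  have g: "g \<in> SLn" and gi: "\<And>a b. g $ a $ b \<in> \<int>" using assms by (auto simp: SLnZ_def)
  have "matrix_inv g $ a $ b \<in> \<int>" for a b
  proof -
    have "g *v column b (matrix_inv g) = column b (g ** matrix_inv g)"
      by (simp add: column_def matrix_matrix_mult_def matrix_vector_mult_def)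
    also have "\<dots> = axis b 1"
      by (simp add: SLn_inverse(1)[OF g] column_def mat_def axis_def vec_eq_iff)
    finally have "column b (matrix_inv g) =
       (\<chi> k. det (\<chi> i j. if j = k then axis b 1 $ i else g $ i $ j) / det g)"
      using cramer[of g] g by (simp add: SLn_def)
    then have "matrix_inv g $ a $ b = det (\<chi> i j. if j = a then axis b 1 $ i else g $ i $ j)"
      using g by (simp add: column_def vec_eq_iff SLn_def)
    also have "\<dots> \<in> \<int>" by (rule det_Ints) (simp add: gi axis_def)
    finally show ?thesis .
  qed
  then show ?thesis by (simp add: SLnZ_def SLn_inverse(3)[OF g])
qed

lemma int_vec_mult: "int_vec v \<Longrightarrow> g \<in> SLnZ \<Longrightarrow> int_vec (v v* g)"
  by (auto simp: int_vec_def SLnZ_def vector_matrix_mult_def intro!: Ints_sum Ints_mult)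

text \<open>A factorisation of \<open>v v* g\<close> through an integer \<open>d\<close> pulls back
  along the inverse of \<open>g\<close>, which is again integral, to a factorisation of
  \<open>v\<close> through the same \<open>d\<close>.\<close>

lemma primitive_mult:
  assumes "primitive v" "g \<in> SLnZ"
  shows "primitive (v v* g)"
proof -
  have g: "g \<in> SLn" using assms(2) by (rule SLnZ_subset)
  have "\<bar>d\<bar> = 1" if "int_vec w" "v v* g = of_int d *\<^sub>R w" for d :: int and w
  proof -
    have "v = of_int d *\<^sub>R (w v* matrix_inv g)"
      using that(2) SLn_vec_cancel(1)[OF g, of v] by (simp add: scaleR_vector_matrix_assoc)
    moreover have "int_vec (w v* matrix_inv g)"
      using that(1) assms(2) by (intro int_vec_mult SLnZ_inverse)
    ultimately show ?thesis using assms(1) unfolding primitive_def by blast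
  qed
  then show ?thesis
    using assms SLn_vec_eq_0[OF g, of v] unfolding primitive_def by (blast intro: int_vec_mult)
qed

text \<open>This makes every lattice point count a function on the quotient. One inclusion suffices,
  since applying it to the inverse of \<open>\<gamma>\<close> yields the other.\<close>

lemma primlat_SLnZ:
  assumes "\<gamma> \<in> SLnZ"
  shows "primlat (\<gamma> ** g) = primlat g"
proof -
  have "primlat (\<delta> ** h) \<subseteq> primlat h" if "\<delta> \<in> SLnZ" for \<delta> h :: "('a,'b) rmat"
    using that by (force simp: primlat_def simp flip: vector_matrix_mul_assoc intro: primitive_mult)
  from this[OF assms, of g] this[OF SLnZ_inverse[OF assms], of "\<gamma> ** g"]
  show ?thesis
    by (simp add: matrix_mul_assoc SLn_inverse(2)[OF SLnZ_subset[OF assms]])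
qed

section \<open>Finiteness and countability of integer vectors and matrices\<close>

lemma finite_bounded_int_fun:
  fixes C :: real
  shows "finite {f :: 'a::finite \<Rightarrow> real. \<forall>a. f a \<in> \<int> \<and> \<bar>f a\<bar> \<le> C}"
proof -
  have "finite ({x :: real. x \<in> \<int> \<and> \<bar>x\<bar> \<le> C})"
    by (rule finite_abs_int_segment)
  then have "finite (PiE UNIV (\<lambda>a::'a. {x :: real. x \<in> \<int> \<and> \<bar>x\<bar> \<le> C}))"
    by (intro finite_PiE) auto
  then show ?thesis by (rule finite_subset[rotated]) auto
qed

lemma finite_int_vec: "finite {v :: ('k::finite,'j::finite) rvec. int_vec v \<and> norm v \<le> C}"
proof -
  have "{v :: ('k,'j) rvec. int_vec v \<and> norm v \<le> C} \<subseteq> vec_lambda ` {f. \<forall>a. f a \<in> \<int> \<and> \<bar>f a\<bar> \<le> C}"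
  proof
    fix v :: "('k,'j) rvec"
    assume "v \<in> {v. int_vec v \<and> norm v \<le> C}"
    then have "($) v \<in> {f. \<forall>a. f a \<in> \<int> \<and> \<bar>f a\<bar> \<le> C}"
      using component_le_norm_cart[of v] by (auto simp: int_vec_def intro: order_trans)
    then show "v \<in> vec_lambda ` {f. \<forall>a. f a \<in> \<int> \<and> \<bar>f a\<bar> \<le> C}"
      by (intro image_eqI[where x = "($) v"]) simp_all
  qed
  then show ?thesis by (rule finite_subset) (intro finite_imageI finite_bounded_int_fun)
qed

lemma finite_SLnZ_bounded: "finite {g :: ('k::finite,'j::finite) rmat. g \<in> SLnZ \<and> norm g \<le> C}"
proof -
  let ?T = "{f :: ('k + 'j) \<times> ('k + 'j) \<Rightarrow> real. \<forall>a. f a \<in> \<int> \<and> \<bar>f a\<bar> \<le> C}"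
  have "{g :: ('k,'j) rmat. g \<in> SLnZ \<and> norm g \<le> C} \<subseteq> (\<lambda>f. \<chi> a b. f (a, b)) ` ?T"
  proof
    fix g :: "('k,'j) rmat"
    assume g: "g \<in> {g \<in> SLnZ. norm g \<le> C}"
    have "\<bar>g $ a $ b\<bar> \<le> C" for a b
      using component_le_norm_cart[of "g $ a" b] Finite_Cartesian_Product.norm_nth_le[of g a] g
      by simp
    then have "(\<lambda>(a, b). g $ a $ b) \<in> ?T" using g by (auto simp: SLnZ_def)
    moreover have "g = (\<chi> a b. (\<lambda>(a, b). g $ a $ b) (a, b))" by (simp add: vec_eq_iff)
    ultimately show "g \<in> (\<lambda>f. \<chi> a b. f (a, b)) ` ?T" by blast
  qed
  then show ?thesis by (rule finite_subset) (intro finite_imageI finite_bounded_int_fun)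
qed

lemma countable_if_finite_norm_bounded:
  assumes "\<And>C. finite {x \<in> S. norm x \<le> C}"
  shows "countable S"
proof -
  have "S = (\<Union>n::nat. {x \<in> S. norm x \<le> real n})"
    using real_arch_simple by blast
  moreover have "countable (\<Union>n::nat. {x \<in> S. norm x \<le> real n})"
    by (rule countable_UN[OF countableI_type]) (rule countable_finite[OF assms])
  ultimately show ?thesis by simp
qed

lemma countable_SLnZ: "countable SLnZ"
  by (rule countable_if_finite_norm_bounded) (rule finite_SLnZ_bounded)

lemma countable_primitive: "countable {v. primitive v}"
proof -
  have "countable {v :: ('a,'b) rvec. int_vec v}"
    by (rule countable_if_finite_norm_bounded) (simp add: finite_int_vec)
  then show ?thesis by (rule countable_subset[rotated]) (auto simp: primitive_def)
qed

section \<open>Cones and local constancy of the counts\<close>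

text \<open>Phrased with \<open>nhds\<close> so that it can be pulled back along a continuous map by
  \<open>eventually_compose_filterlim\<close>.\<close>

lemma notin_frontier_iff:
  "x \<notin> frontier S \<longleftrightarrow> eventually (\<lambda>z. z \<in> S \<longleftrightarrow> x \<in> S) (nhds x)"
proof (cases "x \<in> S")
  case True
  then have "x \<notin> frontier S \<longleftrightarrow> x \<in> interior S"
    using closure_subset by (auto simp: frontier_def)
  also have "\<dots> \<longleftrightarrow> eventually (\<lambda>z. z \<in> S) (nhds x)"
    by (auto simp: eventually_nhds interior_def)
  finally show ?thesis using True by simp
next
  case False
  then have "x \<notin> frontier S \<longleftrightarrow> x \<in> interior (- S)"
    using interior_subset by (auto simp: frontier_def interior_complement)
  also have "\<dots> \<longleftrightarrow> eventually (\<lambda>z. z \<notin> S) (nhds x)"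
    by (auto simp: eventually_nhds interior_def)
  finally show ?thesis using False by simp
qed

text \<open>Coordinates on the cone: the pair of a hitting time and a section parameter
  \<open>w\<close> goes to the vector with last block \<open>w\<close> and first block the
  \<open>jn\<close>-th coordinate of \<open>w\<close> times the hitting time. Source and target have
  equal dimension, so smoothness carries null sets to null sets.\<close>

definition cone_chart :: "'j \<Rightarrow> (real ^ 'k) \<times> (real ^ 'j) \<Rightarrow> ('k::finite,'j::finite) rvec" where
  "cone_chart jn p = (\<chi> c. case c of Inl i \<Rightarrow> (snd p $ jn) * (fst p $ i) | Inr j \<Rightarrow> snd p $ j)"

lemma cone_eq_chart_image: "cone jn A W = cone_chart jn ` (A \<times> W)"
proof (intro set_eqI iffI)
  fix y assume "y \<in> cone jn A W"
  then obtain a where a: "a \<in> A" "ypr y = (y $ Inr jn) *\<^sub>R a" "yjn y \<in> W"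
    by (auto simp: cone_def)
  have "y $ Inl i = y $ Inr jn * a $ i" for i
    using a(2) by (simp add: ypr_def vec_eq_iff)
  then have "y = cone_chart jn (a, yjn y)"
    by (auto simp: cone_chart_def yjn_def vec_eq_iff split: sum.split)
  then show "y \<in> cone_chart jn ` (A \<times> W)" using a by blast
next
  fix y assume "y \<in> cone_chart jn ` (A \<times> W)"
  then show "y \<in> cone jn A W"
    by (auto simp: cone_def cone_chart_def ypr_def yjn_def vec_eq_iff)
qed

lemma cone_chart_differentiable: "cone_chart jn differentiable_on S"
proof -
  \<comment> \<open>\<open>J\<close> merely relabels a pair as one vector; the nonlinearity sits in
    the bilinear term of the map composed with it below.\<close>
  define J where "J = (\<lambda>p :: (real ^ 'a) \<times> (real ^ 'b).
    (\<chi> c. case c of Inl i \<Rightarrow> fst p $ i | Inr j \<Rightarrow> snd p $ j) :: ('a,'b) rvec)"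
  have "linear J"
    by (rule linearI) (auto simp: J_def vec_eq_iff split: sum.split)
  then have "J differentiable at x within T" for x T
    by (rule linear_imp_differentiable)
  moreover have "(\<lambda>p :: (real ^ 'a) \<times> (real ^ 'b). ((snd p $ jn) *\<^sub>R fst p, snd p))
      differentiable at x within T" for x T
  proof -
    have "((\<lambda>p :: (real ^ 'a) \<times> (real ^ 'b). ((snd p $ jn) *\<^sub>R fst p, snd p)) has_derivative
        (\<lambda>h. ((snd x $ jn) *\<^sub>R fst h + (snd h $ jn) *\<^sub>R fst x, snd h))) (at x within T)"
      by (auto intro!: derivative_eq_intros bounded_linear.has_derivative[OF bounded_linear_vec_nth])
    then show ?thesis by (rule differentiableI)
  qed
  ultimately have "(J \<circ> (\<lambda>p. ((snd p $ jn) *\<^sub>R fst p, snd p))) differentiable at x within S" for x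
    by (intro differentiable_chain_within)
  moreover have "J \<circ> (\<lambda>p. ((snd p $ jn) *\<^sub>R fst p, snd p)) = cone_chart jn"
    by (auto simp: J_def cone_chart_def fun_eq_iff vec_eq_iff split: sum.split)
  ultimately show ?thesis by (simp add: differentiable_on_def)
qed

text \<open>Positivity on \<open>W\<close> allows division by the \<open>jn\<close>-th coordinate,
  so the only possible witness from \<open>A\<close> in \<open>cone\<close> is the hitting time
  itself.\<close>

lemma mem_cone_iff:
  assumes "\<forall>w\<in>W. w $ jn > 0"
  shows "y \<in> cone jn A W \<longleftrightarrow> yjn y \<in> W \<and> hit_time jn y \<in> A"
proof (cases "yjn y \<in> W")
  case True
  then have "y $ Inr jn \<noteq> 0" using assms by (force simp: yjn_def)
  then have "ypr y = (y $ Inr jn) *\<^sub>R a \<longleftrightarrow> hit_time jn y = a" for a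
    by (auto simp: hit_time_def)
  then show ?thesis using True by (simp add: cone_def image_iff)
qed (simp add: cone_def)

lemma bounded_cone:
  assumes "bounded A" "bounded W"
  shows "bounded (cone jn A W)"
proof -
  have "compact (cone_chart jn ` (closure A \<times> closure W))"
    using assms by (intro compact_continuous_image compact_Times
        differentiable_imp_continuous_on cone_chart_differentiable) auto
  moreover have "cone jn A W \<subseteq> cone_chart jn ` (closure A \<times> closure W)"
    unfolding cone_eq_chart_image by (intro image_mono Sigma_mono closure_subset)
  ultimately show ?thesis by (blast intro: bounded_subset compact_imp_bounded)
qed

lemma linear_ypr: "linear ypr" and linear_yjn: "linear yjn"
  by (auto intro!: linearI simp: ypr_def yjn_def vec_eq_iff)

lemma cone_borel:
  assumes "A \<in> sets borel" "W \<in> sets borel" "\<forall>w\<in>W. w $ jn > 0"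
  shows "cone jn A W \<in> sets borel"
proof -
  have [measurable]: "ypr \<in> borel_measurable borel" "yjn \<in> borel_measurable borel"
    by (auto intro!: borel_measurable_continuous_onI linear_continuous_on
        linear_conv_bounded_linear[THEN iffD1] linear_ypr linear_yjn)
  note [measurable] = assms(1,2)
  have [measurable]: "hit_time jn \<in> borel_measurable borel"
    unfolding hit_time_def[abs_def] by measurable
  have "cone jn A W = {y \<in> space borel. yjn y \<in> W \<and> hit_time jn y \<in> A}"
    using mem_cone_iff[OF assms(3)] by auto
  also have "\<dots> \<in> sets borel" by measurable
  finally show ?thesis .
qed

lemma negligible_Times:
  fixes A :: "'a::euclidean_space set" and B :: "'b::euclidean_space set"
  assumes "A \<in> sets borel" "B \<in> sets borel" "emeasure lborel A = 0 \<or> emeasure lborel B = 0"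
  shows "negligible (A \<times> B)"
proof -
  have "emeasure (lborel \<Otimes>\<^sub>M lborel) (A \<times> B) = 0"
    using assms by (subst lborel.emeasure_pair_measure_Times) auto
  then have "A \<times> B \<in> null_sets lborel"
    using borel_Times[OF assms(1,2)] by (simp add: lborel_prod null_sets_def)
  then show ?thesis by (simp add: negligible_iff_null_sets null_sets_completionI)
qed

text \<open>Off the hyperplane where the \<open>jn\<close>-th coordinate vanishes,
  \<open>hit_time\<close> and \<open>yjn\<close> are continuous. If neither value lay on a frontier,
  membership in the cone would be locally constant. So the frontier lies in that hyperplane together
  with the chart image of a null set.\<close>

lemma negligible_frontier_cone:
  assumes A: "emeasure lborel (frontier A) = 0" and W: "emeasure lborel (frontier W) = 0"
    and pos: "\<forall>w\<in>W. w $ jn > 0"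
  shows "negligible (frontier (cone jn A W))"
proof -
  let ?B = "frontier A \<times> UNIV \<union> UNIV \<times> frontier W"
  have "frontier (cone jn A W) \<subseteq> {y. axis (Inr jn) 1 \<bullet> y = 0} \<union> cone_chart jn ` ?B"
  proof (rule subsetI, rule ccontr)
    fix y assume y: "y \<in> frontier (cone jn A W)"
      "y \<notin> {y. axis (Inr jn) 1 \<bullet> y = 0} \<union> cone_chart jn ` ?B"
    then have n0: "y $ Inr jn \<noteq> 0" by (simp add: inner_axis')
    have "y = cone_chart jn (hit_time jn y, yjn y)"
      using n0 by (auto simp: cone_chart_def hit_time_def yjn_def ypr_def vec_eq_iff split: sum.split)
    with y have f: "hit_time jn y \<notin> frontier A" "yjn y \<notin> frontier W" by blast+
    have y1: "(yjn \<longlongrightarrow> yjn y) (nhds y)"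
      using linear_yjn linear_conv_bounded_linear bounded_linear.tendsto filterlim_ident by blast
    have y2: "(hit_time jn \<longlongrightarrow> hit_time jn y) (nhds y)"
      unfolding hit_time_def[abs_def] using linear_ypr linear_conv_bounded_linear n0
      by (intro tendsto_intros filterlim_ident bounded_linear.tendsto[of ypr]) auto
    have "eventually (\<lambda>z. (yjn z \<in> W \<longleftrightarrow> yjn y \<in> W) \<and> (hit_time jn z \<in> A \<longleftrightarrow> hit_time jn y \<in> A))
       (nhds y)"
      using f[unfolded notin_frontier_iff] y1 y2
      by (intro eventually_conj) (blast dest: eventually_compose_filterlim)+
    then have "eventually (\<lambda>z. z \<in> cone jn A W \<longleftrightarrow> y \<in> cone jn A W) (nhds y)"
      by eventually_elim (simp add: mem_cone_iff[OF pos])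
    then show False using y(1) notin_frontier_iff by blast
  qed
  moreover have "negligible {y :: ('a,'b) rvec. axis (Inr jn) 1 \<bullet> y = 0}"
    by (rule negligible_hyperplane) (simp add: axis_eq_0_iff)
  moreover have "negligible (cone_chart jn ` ?B)"
  proof (rule negligible_differentiable_image_negligible)
    show "negligible ?B"
      using A W by (intro negligible_Un negligible_Times) auto
  qed (simp_all add: cone_chart_differentiable)
  ultimately show ?thesis by (blast intro: negligible_subset negligible_Un)
qed

section \<open>Lattice point counts near a given lattice\<close>

text \<open>Right multiplication by \<open>g\<close> is injective, so the count can be taken over
  primitive integer vectors, an index set that does not vary with \<open>g\<close>.\<close>

lemma card_primlat_Int:
  assumes "g \<in> SLn"
  shows "card (primlat g \<inter> C) = card {w. primitive w \<and> w v* g \<in> C}"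
    and "finite (primlat g \<inter> C) \<longleftrightarrow> finite {w. primitive w \<and> w v* g \<in> C}"
proof -
  have i: "inj_on (\<lambda>w. w v* g) S" for S
    using SLn_vec_inj[OF assms] by (auto simp: inj_on_def)
  have e: "primlat g \<inter> C = (\<lambda>w. w v* g) ` {w. primitive w \<and> w v* g \<in> C}"
    by (auto simp: primlat_def)
  show "card (primlat g \<inter> C) = card {w. primitive w \<and> w v* g \<in> C}"
    unfolding e by (rule card_image[OF i])
  show "finite (primlat g \<inter> C) \<longleftrightarrow> finite {w. primitive w \<and> w v* g \<in> C}"
    unfolding e by (rule finite_image_iff[OF i])
qed

text \<open>The inverse of \<open>g\<close> bounds \<open>norm w\<close> by a multiple of
  \<open>norm (w v* g)\<close>. For \<open>h\<close> close to \<open>g\<close> the error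
  \<open>w v* (g - h)\<close> costs at most half of \<open>norm w\<close>, which is absorbed into
  the left side.\<close>

lemma eventually_nhds_preimage_norm_bound:
  fixes g :: "('k::finite,'j::finite) rmat"
  assumes g: "g \<in> SLn" and C: "bounded C"
  obtains B where "eventually (\<lambda>h. \<forall>w. w v* h \<in> C \<longrightarrow> norm w \<le> B) (nhds g)"
proof -
  obtain R where R: "\<And>y. y \<in> C \<Longrightarrow> norm y \<le> R" using C by (auto simp: bounded_iff)
  obtain K where K: "K > 0"
    "\<And>(v :: ('k,'j) rvec) (M :: ('k,'j) rmat). norm (v v* M) \<le> norm v * norm M * K"
    using bounded_bilinear.pos_bounded[OF bounded_bilinear_vector_matrix_mult] by blast
  \<comment> \<open>The summand 1 keeps \<open>c\<close> positive, so that it may appear in a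
    denominator.\<close>
  define c where "c = norm (matrix_inv g) * K + 1"
  have c: "c > 0" using K(1) by (simp add: c_def add_nonneg_pos)
  have w: "norm w \<le> norm (w v* g) * c" for w
  proof -
    have "norm w \<le> norm (w v* g) * norm (matrix_inv g) * K"
      using K(2)[of "w v* g" "matrix_inv g"] by (simp add: SLn_vec_cancel[OF g])
    then show ?thesis using norm_ge_zero[of "w v* g"] unfolding c_def by argo
  qed
  have "norm w \<le> 2 * c * R" if "dist h g < 1 / (2 * c * K)" "w v* h \<in> C" for h w
  proof -
    have "norm (w v* g) \<le> norm (w v* h) + norm (w v* (g - h))"
      by (metis add_diff_cancel_left' diff_add_cancel norm_triangle_ineq vector_matrix_mult_diff_rdistrib add.commute)
    also have "norm (w v* (g - h)) \<le> norm w * norm (g - h) * K" by (rule K)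
    also have "norm w * norm (g - h) * K = norm w * (norm (g - h) * K)" by simp
    also have "\<dots> \<le> norm w * (1 / (2 * c))"
      using that(1) K(1) c
      by (intro mult_left_mono) (auto simp: dist_norm norm_minus_commute field_simps)
    also have "norm (w v* h) \<le> R" using that R by simp
    finally have "norm (w v* g) \<le> R + norm w * (1 / (2 * c))" by simp
    then have "norm (w v* g) * c \<le> (R + norm w * (1 / (2 * c))) * c"
      using c by (intro mult_right_mono) auto
    also have "\<dots> = c * R + norm w / 2" using c by (simp add: field_simps)
    finally show ?thesis using w[of w] by simp
  qed
  moreover have "eventually (\<lambda>h. dist h g < 1 / (2 * c * K)) (nhds g)"
    using c K(1) by (intro eventually_nhds_metric[THEN iffD2]) (auto intro!: exI[of _ "1 / (2 * c * K)"])
  ultimately have "eventually (\<lambda>h. \<forall>w. w v* h \<in> C \<longrightarrow> norm w \<le> 2 * c * R) (nhds g)"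
    by (auto elim: eventually_mono)
  then show ?thesis by (rule that)
qed

lemma finite_primlat_Int:
  assumes "g \<in> SLn" "bounded C"
  shows "finite (primlat g \<inter> C)"
proof -
  obtain B where "eventually (\<lambda>h. \<forall>w. w v* h \<in> C \<longrightarrow> norm w \<le> B) (nhds g)"
    using eventually_nhds_preimage_norm_bound[OF assms] by blast
  then have "\<forall>w. w v* g \<in> C \<longrightarrow> norm w \<le> B" by (rule eventually_nhds_x_imp_x)
  then have "{w. primitive w \<and> w v* g \<in> C} \<subseteq> {w. int_vec w \<and> norm w \<le> B}"
    by (auto simp: primitive_def)
  then show ?thesis
    unfolding card_primlat_Int(2)[OF assms(1)] using finite_int_vec finite_subset by blast
qed

text \<open>The uniform norm bound leaves only finitely many integer vectors that can matter for any
  \<open>h\<close> near \<open>g\<close>; each of them keeps its side of \<open>C\<close> because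
  its image under \<open>g\<close> avoids the frontier.\<close>

lemma eventually_nhds_primitive_eq:
  fixes g :: "('k::finite,'j::finite) rmat"
  assumes g: "g \<in> SLn" and C: "bounded C" and F: "primlat g \<inter> frontier C = {}"
  shows "eventually (\<lambda>h. {w. primitive w \<and> w v* h \<in> C} = {w. primitive w \<and> w v* g \<in> C}) (nhds g)"
proof -
  obtain B where B: "eventually (\<lambda>h. \<forall>w. w v* h \<in> C \<longrightarrow> norm w \<le> B) (nhds g)"
    using eventually_nhds_preimage_norm_bound[OF g C] by blast
  let ?P = "{w :: ('k,'j) rvec. primitive w \<and> norm w \<le> B}"
  have fin: "finite ?P"
    by (rule finite_subset[OF _ finite_int_vec[of B]]) (auto simp: primitive_def)
  have "eventually (\<lambda>h. \<forall>w\<in>?P. w v* h \<in> C \<longleftrightarrow> w v* g \<in> C) (nhds g)"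
  proof (rule eventually_ball_finite[OF fin], rule ballI)
    fix w assume "w \<in> ?P"
    then have "w v* g \<notin> frontier C" using F by (auto simp: primlat_def)
    moreover have "((\<lambda>h. w v* h) \<longlongrightarrow> w v* g) (nhds g)"
      by (rule bounded_bilinear.tendsto[OF bounded_bilinear_vector_matrix_mult])
         (auto intro: filterlim_ident)
    ultimately show "eventually (\<lambda>h. w v* h \<in> C \<longleftrightarrow> w v* g \<in> C) (nhds g)"
      unfolding notin_frontier_iff by (blast dest: eventually_compose_filterlim)
  qed
  then show ?thesis
    using B
  proof eventually_elim
    case (elim h)
    then show ?case using eventually_nhds_x_imp_x[OF B] by blast
  qed
qed

section \<open>Lifting the invariant measure to the group\<close>

text \<open>The count is the integral of an indicator against counting measure on a countable set,
  so measurability comes from that of integrals with a parameter.\<close>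

lemma borel_measurable_count:
  assumes I: "countable I" and P: "\<And>i. i \<in> I \<Longrightarrow> Measurable.pred M (P i)"
  shows "(\<lambda>x. emeasure (count_space I) {i\<in>I. P i x}) \<in> borel_measurable M"
proof -
  interpret sigma_finite_measure "count_space I"
    by (rule sigma_finite_measure_count_space_countable[OF I])
  have "(\<lambda>(i, x). indicator {j. P j x} i :: ennreal) \<in> borel_measurable (count_space I \<Otimes>\<^sub>M M)"
  proof (rule measurable_pair_measure_countable1[OF I], simp)
    fix i assume "i \<in> I"
    note [measurable] = P[OF this]
    show "(\<lambda>x. indicator {j. P j x} i :: ennreal) \<in> borel_measurable M"
      by (simp add: indicator_def) measurable
  qed
  then have "(\<lambda>(x, i). indicator {j. P j x} i :: ennreal) \<in> borel_measurable (M \<Otimes>\<^sub>M count_space I)"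
    by (subst measurable_pair_swap_iff) (simp add: split_beta)
  then have "(\<lambda>x. \<integral>\<^sup>+i. indicator {j. P j x} i \<partial>count_space I) \<in> borel_measurable M"
    by (rule borel_measurable_nn_integral)
  moreover have "(\<integral>\<^sup>+i. indicator {j. P j x} i \<partial>count_space I) = emeasure (count_space I) {i\<in>I. P i x}" for x
  proof -
    have "emeasure (count_space I) {i\<in>I. P i x} = (\<integral>\<^sup>+i. indicator {i\<in>I. P i x} i \<partial>count_space I)"
      by (subst nn_integral_indicator) auto
    also have "\<dots> = (\<integral>\<^sup>+i. indicator {j. P j x} i \<partial>count_space I)"
      by (rule nn_integral_cong) (auto simp: indicator_def)
    finally show ?thesis by simp
  qed
  ultimately show ?thesis by simp
qed

text \<open>Invariance of \<open>f\<close> makes its preimages stable under left multiplication by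
  \<open>SLnZ\<close>, which is what membership in \<open>Xsets\<close> requires beyond Borel
  measurability.\<close>

lemma measurable_Xsets:
  assumes M: "space M = SLn" "sets M = Xsets"
    and f: "f \<in> measurable borel K" and inv: "\<And>\<gamma> g. \<gamma> \<in> SLnZ \<Longrightarrow> g \<in> SLn \<Longrightarrow> f (\<gamma> ** g) = f g"
  shows "f \<in> measurable M K"
proof (rule measurableI)
  fix x assume "x \<in> space M"
  show "f x \<in> space K" using measurable_space[OF f, of x] by simp
next
  fix A assume "A \<in> sets K"
  then have [measurable]: "f -` A \<in> sets borel" using measurable_sets[OF f] by simp
  show "f -` A \<inter> space M \<in> sets M"
    unfolding M Xsets_def by (auto simp: inv SLn_mult SLnZ_subset)
qed

definition orbit_count :: "('k::finite,'j::finite) rmat set \<Rightarrow> ('k,'j) rmat \<Rightarrow> ennreal" where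
  "orbit_count B g = emeasure (count_space SLnZ) {\<gamma>\<in>SLnZ. \<gamma> ** g \<in> B}"

text \<open>The map \<open>g \<mapsto> \<gamma> ** g\<close> is not measurable for \<open>Xsets\<close>, so the lift cannot be obtained as an image
  of a product measure; only the count over the whole orbit is measurable.\<close>

definition lift_measure :: "('k::finite,'j::finite) rmat measure \<Rightarrow> ('k,'j) rmat measure" where
  "lift_measure mu = measure_of UNIV (sets borel) (\<lambda>B. \<integral>\<^sup>+g. orbit_count B g \<partial>mu)"

text \<open>Right multiplication by \<open>\<delta>\<close> permutes \<open>SLnZ\<close> and matches
  the two index sets.\<close>

lemma orbit_count_SLnZ:
  assumes "\<delta> \<in> SLnZ"
  shows "orbit_count B (\<delta> ** g) = orbit_count B g"
proof -
  have \<delta>: "\<delta> \<in> SLn" using assms by (rule SLnZ_subset)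
  have "bij_betw (\<lambda>\<gamma>. \<gamma> ** \<delta>) {\<gamma>\<in>SLnZ. \<gamma> ** (\<delta> ** g) \<in> B} {\<gamma>\<in>SLnZ. \<gamma> ** g \<in> B}"
    by (rule bij_betw_byWitness[where f' = "\<lambda>\<gamma>. \<gamma> ** matrix_inv \<delta>"])
       (auto simp: SLn_cancel_right[OF \<delta>] matrix_mul_assoc
          intro: SLnZ_mult SLnZ_inverse assms)
  then show ?thesis
    unfolding orbit_count_def
    by (simp add: emeasure_count_space bij_betw_same_card bij_betw_finite)
qed

lemma borel_measurable_orbit_count:
  assumes M: "space M = SLn" "sets M = Xsets" and [measurable]: "B \<in> sets borel"
  shows "orbit_count B \<in> borel_measurable M"
proof (rule measurable_Xsets[OF M])
  show "orbit_count B \<in> borel_measurable borel"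
    unfolding orbit_count_def[abs_def] by (intro borel_measurable_count countable_SLnZ) measurable
qed (rule orbit_count_SLnZ)

text \<open>Countable additivity is inherited from counting measure pointwise in \<open>g\<close>,
  and then passes through the integral by exchanging sum and integral of nonnegative
  functions.\<close>

lemma
  assumes M: "space mu = SLn" "sets mu = Xsets"
  shows sets_lift_measure: "sets (lift_measure mu) = sets borel"
    and space_lift_measure: "space (lift_measure mu) = UNIV"
    and emeasure_lift_measure:
      "B \<in> sets borel \<Longrightarrow> emeasure (lift_measure mu) B = (\<integral>\<^sup>+g. orbit_count B g \<partial>mu)"
proof -
  show s: "sets (lift_measure mu) = sets borel"
    unfolding lift_measure_def using sets.sigma_sets_eq[of borel] by (simp add: sets_measure_of)
  show "space (lift_measure mu) = UNIV" using sets_eq_imp_space_eq[OF s] by simp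
  assume B: "B \<in> sets borel"
  show "emeasure (lift_measure mu) B = (\<integral>\<^sup>+g. orbit_count B g \<partial>mu)"
  proof (rule emeasure_measure_of[OF lift_measure_def])
    show "positive (sets (lift_measure mu)) (\<lambda>B. \<integral>\<^sup>+g. orbit_count B g \<partial>mu)"
      by (simp add: positive_def orbit_count_def)
    show "countably_additive (sets (lift_measure mu)) (\<lambda>B. \<integral>\<^sup>+g. orbit_count B g \<partial>mu)"
    proof (rule countably_additiveI)
      fix A :: "nat \<Rightarrow> _" assume A: "range A \<subseteq> sets (lift_measure mu)" "disjoint_family A"
      have "(\<Sum>i. orbit_count (A i) g) = orbit_count (\<Union>i. A i) g" for g
      proof -
        have "(\<Sum>i. orbit_count (A i) g) =
            emeasure (count_space SLnZ) (\<Union>i. {\<gamma>\<in>SLnZ. \<gamma> ** g \<in> A i})"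
          unfolding orbit_count_def using A(2)
          by (intro suminf_emeasure) (auto simp: disjoint_family_on_def)
        also have "(\<Union>i. {\<gamma>\<in>SLnZ. \<gamma> ** g \<in> A i}) = {\<gamma>\<in>SLnZ. \<gamma> ** g \<in> (\<Union>i. A i)}" by auto
        finally show ?thesis by (simp add: orbit_count_def)
      qed
      moreover have "(\<Sum>i. \<integral>\<^sup>+g. orbit_count (A i) g \<partial>mu) = (\<integral>\<^sup>+g. (\<Sum>i. orbit_count (A i) g) \<partial>mu)"
        using A(1) s by (intro nn_integral_suminf[symmetric] borel_measurable_orbit_count[OF M]) auto
      ultimately show "(\<Sum>i. \<integral>\<^sup>+g. orbit_count (A i) g \<partial>mu) = (\<integral>\<^sup>+g. orbit_count (\<Union>i. A i) g \<partial>mu)"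
        by simp
    qed
    show "B \<in> sets (lift_measure mu)" using B s by simp
  qed simp
qed

text \<open>If \<open>\<gamma> g\<close> and \<open>\<gamma>' g\<close> both lie in a set on which matrices and their inverses are bounded, then
  the integer matrix \<open>\<gamma> \<gamma>'\<^sup>-\<^sup>1\<close> is bounded.\<close>

lemma orbit_count_bounded:
  fixes c :: real
  defines "S \<equiv> fst ` (cball 0 c \<times> cball 0 c \<inter>
                {p :: ('k::finite,'j::finite) rmat \<times> ('k,'j) rmat. fst p ** snd p = mat 1})"
  obtains n :: nat where "\<And>g. g \<in> SLn \<Longrightarrow> orbit_count S g \<le> of_nat n"
proof -
  obtain K where K: "K > 0"
    "\<And>(v :: ('k,'j) rmat) (M :: ('k,'j) rmat). norm (v ** M) \<le> norm v * norm M * K"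
    using bounded_bilinear.pos_bounded[OF bounded_bilinear_matrix_matrix_mult] by blast
  let ?D = "{\<delta> :: ('k,'j) rmat. \<delta> \<in> SLnZ \<and> norm \<delta> \<le> c * c * K}"
  have "orbit_count S g \<le> of_nat (card ?D)" if g: "g \<in> SLn" for g
  proof (cases "{\<gamma>\<in>SLnZ. \<gamma> ** g \<in> S} = {}")
    case False
    then obtain \<gamma>0 k where \<gamma>0: "\<gamma>0 \<in> SLnZ" "\<gamma>0 ** g ** k = mat 1" "norm k \<le> c"
      by (auto simp: S_def)
    \<comment> \<open>\<open>k\<close> inverts \<open>\<gamma>0 ** g\<close>, so multiplying
      \<open>\<gamma>\<close> by the inverse of \<open>\<gamma>0\<close> gives
      \<open>(\<gamma> ** g) ** k\<close>, a product of two bounded matrices.\<close>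
    have i: "matrix_inv \<gamma>0 = g ** k"
    proof -
      have "matrix_inv \<gamma>0 = matrix_inv \<gamma>0 ** (\<gamma>0 ** (g ** k))"
        using \<gamma>0(2) by (simp add: matrix_mul_assoc)
      also have "\<dots> = g ** k"
        using SLn_inverse(2)[OF SLnZ_subset[OF \<gamma>0(1)]] by (simp add: matrix_mul_assoc)
      finally show ?thesis .
    qed
    have inj: "inj_on (\<lambda>\<gamma>. \<gamma> ** matrix_inv \<gamma>0) {\<gamma>\<in>SLnZ. \<gamma> ** g \<in> S}"
      by (rule inj_on_inverseI[where g = "\<lambda>\<gamma>. \<gamma> ** \<gamma>0"])
         (simp add: SLn_cancel_right[OF SLnZ_subset[OF \<gamma>0(1)]])
    have im: "(\<lambda>\<gamma>. \<gamma> ** matrix_inv \<gamma>0) ` {\<gamma>\<in>SLnZ. \<gamma> ** g \<in> S} \<subseteq> ?D"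
    proof clarify
      fix \<gamma> assume \<gamma>: "\<gamma> \<in> SLnZ" "\<gamma> ** g \<in> S"
      have "norm (\<gamma> ** matrix_inv \<gamma>0) \<le> norm (\<gamma> ** g) * norm k * K"
        using K(2)[of "\<gamma> ** g" k] by (simp add: i matrix_mul_assoc)
      also have "\<dots> \<le> c * c * K"
        using \<gamma>(2) \<gamma>0(3) K(1)
        by (intro mult_mono) (auto simp: S_def intro: order_trans[OF norm_ge_zero])
      finally show "\<gamma> ** matrix_inv \<gamma>0 \<in> SLnZ \<and> norm (\<gamma> ** matrix_inv \<gamma>0) \<le> c * c * K"
        using \<gamma>(1) \<gamma>0(1) by (simp add: SLnZ_mult SLnZ_inverse)
    qed
    have "finite {\<gamma>\<in>SLnZ. \<gamma> ** g \<in> S}" "card {\<gamma>\<in>SLnZ. \<gamma> ** g \<in> S} \<le> card ?D"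
      using inj im finite_SLnZ_bounded[of "c * c * K"]
      by (blast intro: inj_on_finite card_inj_on_le)+
    then show ?thesis by (simp add: orbit_count_def emeasure_count_space)
  next
    case True
    then show ?thesis unfolding orbit_count_def by (simp only: True emeasure_empty zero_le)
  qed
  then show ?thesis by (rule that)
qed

lemma emeasure_lift_measure_Compl_SLn:
  assumes M: "space mu = SLn" "sets mu = Xsets"
  shows "emeasure (lift_measure mu) (- SLn) = 0"
proof -
  have "orbit_count (- SLn) g = 0" if "g \<in> SLn" for g :: "('a,'b) rmat"
  proof -
    have "{\<gamma>\<in>SLnZ. \<gamma> ** g \<in> - SLn} = {}" using that SLn_mult[OF SLnZ_subset] by auto
    then show ?thesis unfolding orbit_count_def by (simp only: emeasure_empty)
  qed
  then have "(\<integral>\<^sup>+g. orbit_count (- SLn) g \<partial>mu) = (\<integral>\<^sup>+g. 0 \<partial>mu)"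
    by (intro nn_integral_cong) (simp add: M)
  then show ?thesis by (subst emeasure_lift_measure[OF M]) auto
qed

lemma AE_lift_measure_SLn:
  assumes M: "space mu = SLn" "sets mu = Xsets"
  shows "AE g in lift_measure mu. g \<in> SLn"
  using emeasure_lift_measure_Compl_SLn[OF M]
  by (intro AE_I[where N = "- SLn"]) (auto simp: sets_lift_measure[OF M])

text \<open>The sets \<open>S n\<close> exhaust \<open>SLn\<close>; each has finite measure because
  its orbit count is bounded and \<open>mu\<close> is finite. The complement of \<open>SLn\<close>
  is null.\<close>

lemma sigma_finite_lift_measure:
  fixes mu :: "('k::finite,'j::finite) rmat measure"
  assumes M: "space mu = SLn" "sets mu = Xsets" and fin: "finite_measure mu"
  shows "sigma_finite_measure (lift_measure mu)"
proof
  \<comment> \<open>As the projection of a closed bounded set of pairs (matrix, right inverse),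
    \<open>S c\<close> is a continuous image of a compact set.\<close>
  define S where "S c = fst ` (cball 0 c \<times> cball 0 c \<inter>
                {p :: ('k,'j) rmat \<times> ('k,'j) rmat. fst p ** snd p = mat 1})" for c :: real
  have S_borel: "S c \<in> sets borel" for c
  proof -
    have "closed {p :: ('k,'j) rmat \<times> ('k,'j) rmat. fst p ** snd p = mat 1}"
      by (intro closed_Collect_eq continuous_on_matrix_matrix_mult continuous_intros)
    then have "compact (S c)"
      unfolding S_def by (intro compact_continuous_image compact_Int_closed compact_Times
          compact_cball continuous_intros)
    then show ?thesis by (intro borel_closed compact_imp_closed)
  qed
  let ?A = "insert (- SLn) (range (\<lambda>n. S (real n)))"
  have "(\<Union>n. S (real n)) \<supseteq> SLn"
  proof
    fix g :: "('k,'j) rmat" assume g: "g \<in> SLn"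
    obtain n where "max (norm g) (norm (matrix_inv g)) \<le> real n" using real_arch_simple by blast
    then have "(g, matrix_inv g) \<in> cball 0 (real n) \<times> cball 0 (real n) \<inter> {p. fst p ** snd p = mat 1}"
      using SLn_inverse[OF g] by auto
    then have "g \<in> S (real n)" unfolding S_def by force
    then show "g \<in> (\<Union>n. S (real n))" by blast
  qed
  then have un: "\<Union>?A = space (lift_measure mu)"
    by (auto simp: space_lift_measure[OF M])
  have "emeasure (lift_measure mu) (S c) \<noteq> \<infinity>" for c
  proof -
    obtain n :: nat where n: "\<And>g :: ('k,'j) rmat. g \<in> SLn \<Longrightarrow> orbit_count (S c) g \<le> of_nat n"
      using orbit_count_bounded unfolding S_def by blast
    have "emeasure (lift_measure mu) (S c) = (\<integral>\<^sup>+g. orbit_count (S c) g \<partial>mu)"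
      by (rule emeasure_lift_measure[OF M S_borel])
    also have "\<dots> \<le> (\<integral>\<^sup>+g. of_nat n \<partial>mu)" by (intro nn_integral_mono) (simp add: M n)
    also have "\<dots> < \<infinity>"
      using finite_measure.emeasure_finite[OF fin]
      by (simp add: ennreal_mult_less_top of_nat_less_top less_top)
    finally show ?thesis by simp
  qed
  moreover note emeasure_lift_measure_Compl_SLn[OF M]
  ultimately show "\<exists>A. countable A \<and> A \<subseteq> sets (lift_measure mu) \<and> \<Union>A = space (lift_measure mu) \<and>
      (\<forall>a\<in>A. emeasure (lift_measure mu) a \<noteq> \<infinity>)"
    using un S_borel SLn_borel by (intro exI[of _ ?A]) (auto simp: sets_lift_measure[OF M])
qed

section \<open>Right translation invariance of the lift\<close>

lemma Haar_X_D:
  assumes "Haar_X mu"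
  shows "prob_space mu" "space mu = SLn" "sets mu = Xsets"
    "\<And>h E. h \<in> SLn \<Longrightarrow> E \<in> Xsets \<Longrightarrow> emeasure mu (rtrans E h) = emeasure mu E"
  using assms by (auto simp: Haar_X_def Xprob_def)

text \<open>Turns an image into a preimage under a continuous map, from which measurability can be
  read off.\<close>

lemma rtrans_eq:
  assumes "h \<in> SLn" "E \<subseteq> SLn"
  shows "rtrans E h = {g \<in> SLn. g ** matrix_inv h \<in> E}"
proof -
  have "g \<in> (\<lambda>g. g ** h) ` E" if "g ** matrix_inv h \<in> E" for g
    using that by (intro image_eqI[where x = "g ** matrix_inv h"]) (simp_all add: SLn_cancel_right[OF assms(1)])
  then show ?thesis
    using assms by (auto simp: rtrans_def SLn_cancel_right[OF assms(1)] SLn_mult)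
qed

lemma matrix_inv_matrix_inv:
  assumes "h \<in> SLn"
  shows "matrix_inv (matrix_inv h) = h"
  using SLn_cancel_right(2)[OF SLn_inverse(3)[OF assms], of h] SLn_inverse[OF assms]
  by (metis SLn_cancel_right(1) SLn_inverse(1,3) assms matrix_mul_assoc matrix_mul_lid)

lemma rtrans_Xsets:
  assumes h: "h \<in> SLn" and E: "E \<in> Xsets"
  shows "rtrans E h \<in> Xsets"
proof -
  have [measurable]: "E \<in> sets borel" and E': "E \<subseteq> SLn" using E by (auto simp: Xsets_def)
  have "{g \<in> space borel. g ** matrix_inv h \<in> E} \<in> sets borel" by measurable
  then have "SLn \<inter> {g. g ** matrix_inv h \<in> E} \<in> sets borel" by (intro sets.Int SLn_borel) simp
  then show ?thesis
    using E unfolding rtrans_eq[OF h E']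
    by (auto simp: Xsets_def Int_def SLn_mult SLnZ_subset simp flip: matrix_mul_assoc)
qed

lemma emeasure_Haar_X_translate:
  assumes mu: "Haar_X mu" and h: "h \<in> SLn" and E: "E \<in> Xsets"
  shows "emeasure mu {g \<in> SLn. g ** h \<in> E} = emeasure mu E"
proof -
  have "{g \<in> SLn. g ** h \<in> E} = rtrans E (matrix_inv h)"
    using E by (subst rtrans_eq) (auto simp: SLn_inverse h matrix_inv_matrix_inv Xsets_def)
  then show ?thesis using Haar_X_D(4)[OF mu SLn_inverse(3)[OF h] E] by simp
qed

text \<open>Counting over left \<open>SLnZ\<close>-orbits commutes with right translation: the count
  of the translated set at \<open>g\<close> is \<open>orbit_count B (g ** h)\<close>. Invariance of
  \<open>mu\<close> then removes \<open>h\<close> from the integral.\<close>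

lemma lift_measure_translate:
  assumes mu: "Haar_X mu" and h: "h \<in> SLn" and B[measurable]: "B \<in> sets borel"
  shows "emeasure (lift_measure mu) {g. g ** h \<in> B} = emeasure (lift_measure mu) B"
proof -
  note M = Haar_X_D(2,3)[OF mu]
  have m: "(\<lambda>g. g ** h) \<in> measurable mu mu"
  proof (rule measurableI)
    fix E assume E: "E \<in> sets mu"
    have "(\<lambda>g. g ** h) -` E \<inter> space mu = rtrans E (matrix_inv h)"
      using E by (subst rtrans_eq) (auto simp: M SLn_inverse h matrix_inv_matrix_inv Xsets_def)
    then show "(\<lambda>g. g ** h) -` E \<inter> space mu \<in> sets mu"
      using E rtrans_Xsets[OF SLn_inverse(3)[OF h]] by (simp add: M)
  qed (simp add: M SLn_mult h)
  have d: "distr mu mu (\<lambda>g. g ** h) = mu"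
  proof (rule measure_eqI)
    fix E assume E: "E \<in> sets (distr mu mu (\<lambda>g. g ** h))"
    have "(\<lambda>g. g ** h) -` E \<inter> space mu = {g \<in> SLn. g ** h \<in> E}" by (auto simp: M)
    then show "emeasure (distr mu mu (\<lambda>g. g ** h)) E = emeasure mu E"
      using E emeasure_Haar_X_translate[OF mu h, of E] by (simp add: emeasure_distr[OF m] M)
  qed simp
  have [measurable]: "{g. g ** h \<in> B} \<in> sets borel"
  proof -
    have "{g \<in> space borel. g ** h \<in> B} \<in> sets borel" by measurable
    then show ?thesis by simp
  qed
  have "emeasure (lift_measure mu) {g. g ** h \<in> B} = (\<integral>\<^sup>+g. orbit_count B (g ** h) \<partial>mu)"
    by (simp add: emeasure_lift_measure[OF M] orbit_count_def matrix_mul_assoc)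
  also have "\<dots> = (\<integral>\<^sup>+g. orbit_count B g \<partial>distr mu mu (\<lambda>g. g ** h))"
    by (rule nn_integral_distr[symmetric, OF m]) (rule borel_measurable_orbit_count[OF _ _ B], simp_all add: M)
  finally show ?thesis by (simp add: d emeasure_lift_measure[OF M])
qed

text \<open>Fubini for the set of pairs \<open>(g, s)\<close> with \<open>g ** h s\<close> in
  \<open>S\<close>. Integrating over \<open>s\<close> first gives 0; integrating over
  \<open>g\<close> first gives, by invariance, the measure of \<open>S\<close> times the total
  Lebesgue mass.\<close>

lemma lift_measure_null_by_translates:
  fixes h :: "'p::euclidean_space \<Rightarrow> ('k::finite,'j::finite) rmat"
  assumes mu: "Haar_X mu" and h[measurable]: "h \<in> borel_measurable borel" and hS: "\<And>s. h s \<in> SLn"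
    and S[measurable]: "S \<in> sets borel"
    and null: "AE g in lift_measure mu. emeasure lborel {s. g ** h s \<in> S} = 0"
  shows "emeasure (lift_measure mu) S = 0"
proof -
  note M = Haar_X_D(2,3)[OF mu]
  interpret prob_space mu by (rule Haar_X_D[OF mu])
  interpret L: sigma_finite_measure "lift_measure mu"
    by (rule sigma_finite_lift_measure[OF M]) unfold_locales
  interpret P: pair_sigma_finite "lift_measure mu" "lborel :: 'p measure" ..
  define T where "T = {p :: ('k,'j) rmat \<times> 'p. fst p ** h (snd p) \<in> S}"
  have "{p \<in> space (borel \<Otimes>\<^sub>M borel). fst p ** h (snd p) \<in> S} \<in> sets (borel \<Otimes>\<^sub>M borel)"
    by measurable
  moreover have "sets (lift_measure mu \<Otimes>\<^sub>M (lborel :: 'p measure)) = sets (borel \<Otimes>\<^sub>M borel)"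
    by (intro sets_pair_measure_cong) (simp_all add: sets_lift_measure[OF M])
  ultimately have T: "T \<in> sets (lift_measure mu \<Otimes>\<^sub>M (lborel :: 'p measure))"
    by (simp add: T_def space_pair_measure)
  have "emeasure (lift_measure mu \<Otimes>\<^sub>M lborel) T = (\<integral>\<^sup>+g. emeasure lborel {s. g ** h s \<in> S} \<partial>lift_measure mu)"
    by (subst lborel.emeasure_pair_measure_alt[OF T]) (simp add: T_def vimage_def)
  also have "\<dots> = (\<integral>\<^sup>+g. 0 \<partial>lift_measure mu)"
    using null by (rule nn_integral_cong_AE)
  finally have 0: "emeasure (lift_measure mu \<Otimes>\<^sub>M lborel) T = 0" by simp
  have "emeasure (lift_measure mu \<Otimes>\<^sub>M lborel) T = (\<integral>\<^sup>+s. emeasure (lift_measure mu) {g. g ** h s \<in> S} \<partial>(lborel :: 'p measure))"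
    by (subst P.emeasure_pair_measure_alt2[OF T]) (simp add: T_def vimage_def)
  also have "\<dots> = (\<integral>\<^sup>+s. emeasure (lift_measure mu) S \<partial>(lborel :: 'p measure))"
    by (simp add: lift_measure_translate[OF mu hS S])
  \<comment> \<open>The Lebesgue mass of the whole space is infinite, so the product can vanish only
    if \<open>S\<close> is null.\<close>
  also have "\<dots> = emeasure (lift_measure mu) S * \<infinity>" by simp
  finally show ?thesis using 0 by simp
qed

section \<open>Null sets of lattice translates\<close>

definition elem_mat :: "'k + 'j \<Rightarrow> 'k + 'j \<Rightarrow> real \<Rightarrow> ('k::finite,'j::finite) rmat" where
  "elem_mat c a s = mat 1 + s *\<^sub>R (\<chi> i j. if i = c \<and> j = a then 1 else 0)"

text \<open>The shear fixes coordinate \<open>a\<close> of a row vector and ignores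
  \<open>s $ a\<close>. That free parameter later drives an elementary matrix moving coordinate
  \<open>a\<close>, so that together all n coordinates move.\<close>

definition shear_mat :: "'k + 'j \<Rightarrow> ('k,'j) rvec \<Rightarrow> ('k::finite,'j::finite) rmat" where
  "shear_mat a s = mat 1 + (\<chi> i j. if i = a \<and> j \<noteq> a then s $ j else 0)"

lemma elem_mat_SLn:
  assumes "c \<noteq> a"
  shows "elem_mat c a s \<in> SLn"
proof -
  have "elem_mat c a s = (\<chi> k. if k = c then row c (mat 1) + s *s row a (mat 1) else row k (mat 1))"
    using assms by (auto simp: elem_mat_def vec_eq_iff row_def mat_def)
  then show ?thesis
    using det_row_operation[OF assms, of "mat 1" s] by (simp add: SLn_def)
qed

text \<open>Only row \<open>a\<close> of the identity changes, by a combination \<open>x\<close> of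
  the other rows, so the determinant stays 1.\<close>

lemma shear_mat_SLn: "shear_mat a s \<in> SLn"
proof -
  define x where "x = (\<Sum>b\<in>UNIV - {a}. s $ b *s row b (mat 1 :: ('a,'b) rmat))"
  have "x \<in> vec.span {row j (mat 1 :: ('a,'b) rmat) |j. j \<noteq> a}"
    unfolding x_def by (intro vec.span_sum vec.span_scale vec.span_base) auto
  then have "det (\<chi> k. if k = a then row a (mat 1) + x else row k (mat 1)) = det (mat 1 :: ('a,'b) rmat)"
    by (rule det_row_span)
  moreover have "x $ j = (if j = a then 0 else s $ j)" for j
    by (auto simp: x_def row_def mat_def if_distrib[of "\<lambda>u. _ * u"] sum.delta cong: if_cong)
  then have "shear_mat a s = (\<chi> k. if k = a then row a (mat 1) + x else row k (mat 1))"
    by (auto simp: shear_mat_def vec_eq_iff row_def mat_def)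
  ultimately show ?thesis by (simp add: SLn_def)
qed

lemma vec_elem_mat: "v v* elem_mat c a s = v + (s * v $ c) *\<^sub>R axis a 1"
proof -
  have "(v v* (\<chi> i j. if i = c \<and> j = a then 1 else 0)) $ j = (v $ c *\<^sub>R axis a 1) $ j" for j
    by (auto simp: vector_matrix_mult_def axis_def if_distrib[of "\<lambda>u. _ * u"] sum.delta cong: if_cong)
  then have "v v* (\<chi> i j. if i = c \<and> j = a then 1 else 0) = v $ c *\<^sub>R axis a 1"
    by (simp add: vec_eq_iff)
  then show ?thesis
    unfolding elem_mat_def vector_matrix_mult_add_rdistrib vector_scaleR_matrix_ac
    by (simp add: scaleR_vector_matrix_assoc)
qed

lemma vec_shear_mat: "(v v* shear_mat a s) $ j = (if j = a then v $ a else v $ j + v $ a * s $ j)"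
proof -
  have "(v v* (\<chi> i j. if i = a \<and> j \<noteq> a then s $ j else 0)) $ j = (if j = a then 0 else v $ a * s $ j)"
    by (auto simp: vector_matrix_mult_def if_distrib[of "\<lambda>u. _ * u"] sum.delta cong: if_cong)
  then show ?thesis
    by (simp add: shear_mat_def vector_matrix_mult_add_rdistrib)
qed

lemma borel_measurable_elem_mat [measurable]: "elem_mat c a \<in> borel_measurable borel"
  unfolding elem_mat_def[abs_def]
  by (intro borel_measurable_continuous_onI continuous_intros)

lemma borel_measurable_shear_mat [measurable]: "shear_mat a \<in> borel_measurable borel"
proof -
  have "continuous_on UNIV (\<lambda>s. if i = a \<and> j \<noteq> a then s $ j else 0 :: real)" for i j
    by (cases "i = a \<and> j \<noteq> a") (auto intro: continuous_intros)
  then show ?thesis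
    unfolding shear_mat_def[abs_def]
    by (intro borel_measurable_continuous_onI continuous_intros)
qed

text \<open>If coordinate \<open>c\<close> of \<open>w v* g\<close> vanishes, some other coordinate
  \<open>b\<close> does not. Translating by \<open>elem_mat b c s\<close> adds \<open>s\<close>
  times coordinate \<open>b\<close> to coordinate \<open>c\<close>, so at most one \<open>s\<close>
  produces a zero there, and a single point is Lebesgue null.\<close>

lemma AE_lift_measure_coord_nonzero:
  fixes w :: "('k::finite,'j::finite) rvec"
  assumes mu: "Haar_X mu" and w: "w \<noteq> 0"
  shows "AE g in lift_measure mu. g \<in> SLn \<longrightarrow> (w v* g) $ c \<noteq> 0"
proof -
  note M = Haar_X_D(2,3)[OF mu]
  let ?S = "\<lambda>b. {g :: ('k,'j) rmat. (w v* g) $ c = 0 \<and> (w v* g) $ b \<noteq> 0}"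
  have S[measurable]: "?S b \<in> sets borel" for b
  proof -
    have "{g \<in> space borel. (w v* g) $ c = 0 \<and> (w v* g) $ b \<noteq> 0} \<in> sets borel" by measurable
    then show ?thesis by simp
  qed
  have "emeasure (lift_measure mu) (?S b) = 0" if "b \<noteq> c" for b
  proof (rule lift_measure_null_by_translates[OF mu _ elem_mat_SLn[OF that] S])
    have sub: "{s. g ** elem_mat b c s \<in> ?S b} \<subseteq> {- (w v* g) $ c / (w v* g) $ b}" for g
      using that by (auto simp: vec_elem_mat axis_def field_simps simp flip: vector_matrix_mul_assoc)
    have "emeasure lborel {s. g ** elem_mat b c s \<in> ?S b} = 0" for g
      by (rule emeasure_lborel_countable[OF countable_subset[OF sub]]) simp
    then show "AE g in lift_measure mu. emeasure lborel {s. g ** elem_mat b c s \<in> ?S b} = 0"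
      by simp
  qed measurable
  then have "AE g in lift_measure mu. \<forall>b\<in>UNIV - {c}. g \<notin> ?S b"
    by (intro AE_finite_allI AE_not_in) (auto simp: null_sets_def sets_lift_measure[OF M])
  then show ?thesis
  proof eventually_elim
    case (elim g)
    show ?case
    proof (intro impI notI)
      assume "g \<in> SLn" "(w v* g) $ c = 0"
      then have "w v* g = 0" using elim by (auto simp: vec_eq_iff) 
      then show False using SLn_vec_eq_0[OF \<open>g \<in> SLn\<close>] w by simp
    qed
  qed
qed

text \<open>Where \<open>y $ a \<noteq> 0\<close>, the map \<open>s \<mapsto> y\<close> is inverted by the rational map \<open>\<psi>\<close> below: first
  \<open>s $ a\<close> is read off \<open>y $ a = v $ a + s $ a * v $ c\<close>, then the other coordinates of \<open>s\<close>.\<close>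

lemma negligible_shear_preimage:
  fixes v :: "('k::finite,'j::finite) rvec"
  assumes ac: "a \<noteq> c" and v: "v $ c \<noteq> 0" and F: "negligible F"
  shows "negligible {s. v v* elem_mat c a (s $ a) v* shear_mat a s \<in> F}"
proof -
  \<comment> \<open>The first term recovers every \<open>s $ b\<close> with
    \<open>b \<noteq> a\<close>; the multiple of \<open>axis a 1\<close> replaces its wrong entry at
    \<open>a\<close> by \<open>(y $ a - v $ a) / v $ c\<close>.\<close>
  define \<psi> where "\<psi> y = inverse (y $ a) *\<^sub>R (y - v) +
    ((y $ a - v $ a) / v $ c - inverse (y $ a) * (y $ a - v $ a)) *\<^sub>R axis a 1" for y :: "('k,'j) rvec"
  have "{s. v v* elem_mat c a (s $ a) v* shear_mat a s \<in> F} \<subseteq>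
      {s. axis a 1 \<bullet> s = - v $ a / v $ c} \<union> \<psi> ` (F \<inter> {y. y $ a \<noteq> 0})"
  proof
    fix s assume s: "s \<in> {s. v v* elem_mat c a (s $ a) v* shear_mat a s \<in> F}"
    define y where "y = v v* elem_mat c a (s $ a) v* shear_mat a s"
    have y: "y $ a = v $ a + s $ a * v $ c" "\<And>b. b \<noteq> a \<Longrightarrow> y $ b = v $ b + y $ a * s $ b"
      by (simp_all add: y_def vec_shear_mat vec_elem_mat axis_def)
    show "s \<in> {s. axis a 1 \<bullet> s = - v $ a / v $ c} \<union> \<psi> ` (F \<inter> {y. y $ a \<noteq> 0})"
    proof (cases "y $ a = 0")
      case True
      then have "axis a 1 \<bullet> s = - v $ a / v $ c"
        using y(1) v by (simp add: inner_axis' field_simps)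
      then show ?thesis by simp
    next
      case False
      have "\<psi> y $ b = s $ b" for b
      proof (cases "b = a")
        case True
        then show ?thesis using v by (simp add: \<psi>_def axis_def) (simp add: y(1))
      next
        case b: False
        then have "\<psi> y $ b = inverse (y $ a) * (y $ a * s $ b)"
          using y(2)[OF b] by (simp add: \<psi>_def axis_def)
        then show ?thesis using False by simp
      qed
      then have "s = \<psi> y" by (simp add: vec_eq_iff)
      then show ?thesis using s False by (auto simp: y_def)
    qed
  qed
  moreover have "negligible {s :: ('k,'j) rvec. axis a 1 \<bullet> s = - v $ a / v $ c}"
    by (rule negligible_hyperplane) (simp add: axis_eq_0_iff)
  moreover have "negligible (\<psi> ` (F \<inter> {y. y $ a \<noteq> 0}))"
  proof (rule negligible_differentiable_image_negligible)
    show "negligible (F \<inter> {y. y $ a \<noteq> 0})" using F by (rule negligible_subset) auto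
    have nth: "(\<lambda>y :: ('k,'j) rvec. y $ a) differentiable at x within T" for x T
      by (rule bounded_linear_imp_differentiable[OF bounded_linear_vec_nth])
    show "\<psi> differentiable_on F \<inter> {y. y $ a \<noteq> 0}"
      unfolding differentiable_on_def \<psi>_def[abs_def] divide_inverse
      by (auto intro!: derivative_intros nth simp: differentiable_inverse)
  qed simp
  ultimately show ?thesis by (blast intro: negligible_subset negligible_Un)
qed

text \<open>For almost every \<open>g\<close> the vector \<open>v = w v* g\<close> has nonzero
  coordinate \<open>c\<close>, so the parameters \<open>s\<close> that send it into \<open>F\<close>
  form a null set, and translates by \<open>?h s\<close> can be used.\<close>

lemma lift_measure_vec_null:
  fixes w :: "('k::finite,'j::finite) rvec"
  assumes mu: "Haar_X mu" and w: "w \<noteq> 0" and F: "negligible F" and Fb[measurable]: "F \<in> sets borel"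
  shows "emeasure (lift_measure mu) {g. w v* g \<in> F} = 0"
proof -
  note M = Haar_X_D(2,3)[OF mu]
  \<comment> \<open>Both index blocks are nonempty, so there are two distinct coordinates.\<close>
  obtain a c :: "'k + 'j" where ac: "a \<noteq> c" using sum.distinct(1)[where 'a='k and 'b='j] by blast
  let ?h = "\<lambda>s :: ('k,'j) rvec. elem_mat c a (s $ a) ** shear_mat a s"
  have h[measurable]: "?h \<in> borel_measurable borel" by measurable
  have "{g \<in> space borel. w v* g \<in> F} \<in> sets borel" by measurable
  then have S: "{g. w v* g \<in> F} \<in> sets borel" by simp
  show ?thesis
  proof (rule lift_measure_null_by_translates[OF mu h _ S])
    show "?h s \<in> SLn" for s using ac by (intro SLn_mult elem_mat_SLn shear_mat_SLn) auto
    show "AE g in lift_measure mu. emeasure lborel {s. g ** ?h s \<in> {g. w v* g \<in> F}} = 0"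
      using AE_lift_measure_coord_nonzero[OF mu w, of c] AE_lift_measure_SLn[OF M]
    proof eventually_elim
      case (elim g)
      then have "negligible {s. w v* g v* elem_mat c a (s $ a) v* shear_mat a s \<in> F}"
        by (intro negligible_shear_preimage ac F) auto
      moreover have "w v* g v* elem_mat c a (s $ a) v* shear_mat a s = w v* (g ** ?h s)" for s
        by (simp add: vector_matrix_mul_assoc matrix_mul_assoc)
      ultimately have "{s. w v* (g ** ?h s) \<in> F} \<in> null_sets lebesgue"
        by (simp add: negligible_iff_null_sets)
      moreover have "{s \<in> space borel. w v* (g ** ?h s) \<in> F} \<in> sets borel" by measurable
      ultimately show ?case by (simp add: null_sets_completion_iff null_setsD1)
    qed
  qed
qed

lemma primlat_hits_Xsets:
  assumes "F \<in> sets borel"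
  shows "{g \<in> SLn. primlat g \<inter> F \<noteq> {}} \<in> Xsets"
proof -
  note [measurable] = assms
  have eq: "{g \<in> SLn. primlat g \<inter> F \<noteq> {}} = SLn \<inter> (\<Union>w\<in>{w. primitive w}. {g. w v* g \<in> F})"
    by (auto simp: primlat_def)
  have "{g \<in> space borel. w v* g \<in> F} \<in> sets borel" for w :: "('a,'b) rvec" by measurable
  then have "{g \<in> SLn. primlat g \<inter> F \<noteq> {}} \<in> sets borel"
    unfolding eq by (intro sets.Int SLn_borel sets.countable_UN' countable_primitive) auto
  then show ?thesis by (auto simp: Xsets_def SLn_mult SLnZ_subset primlat_SLnZ)
qed

text \<open>Sums the null sets of the individual primitive vectors in the lift, then descends to
  \<open>mu\<close> by comparing an indicator with an orbit count.\<close>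

lemma Haar_primlat_null:
  fixes mu :: "('k::finite,'j::finite) rmat measure"
  assumes mu: "Haar_X mu" and F: "negligible F" and Fb[measurable]: "F \<in> sets borel"
  shows "emeasure mu {g \<in> SLn. primlat g \<inter> F \<noteq> {}} = 0"
proof -
  note M = Haar_X_D(2,3)[OF mu]
  let ?Z = "{g \<in> SLn. primlat g \<inter> F \<noteq> {}}"
  have Z: "?Z \<in> Xsets" by (rule primlat_hits_Xsets[OF Fb])
  then have Zb: "?Z \<in> sets borel" by (simp add: Xsets_def)
  have "{g. w v* g \<in> F} \<in> null_sets (lift_measure mu)" if "primitive w" for w
  proof -
    have "{g \<in> space borel. w v* g \<in> F} \<in> sets borel" by measurable
    then show ?thesis
      using lift_measure_vec_null[OF mu _ F Fb, of w] that
      by (simp add: null_sets_def sets_lift_measure[OF M] primitive_def)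
  qed
  then have "(\<Union>w\<in>{w. primitive w}. {g. w v* g \<in> F}) \<in> null_sets (lift_measure mu)"
    by (intro null_sets_UN' countable_primitive) auto
  then have "?Z \<in> null_sets (lift_measure mu)"
  proof (rule null_sets_subset)
    show "?Z \<in> sets (lift_measure mu)" using Zb by (simp add: sets_lift_measure[OF M])
  qed (auto simp: primlat_def)
  then have 0: "(\<integral>\<^sup>+g. orbit_count ?Z g \<partial>mu) = 0"
    using emeasure_lift_measure[OF M Zb] by (simp add: null_sets_def)
  have "emeasure mu ?Z = (\<integral>\<^sup>+g. indicator ?Z g \<partial>mu)" using Z by (simp add: M)
  \<comment> \<open>If \<open>g\<close> lies in \<open>?Z\<close>, the identity of
    \<open>SLnZ\<close> already contributes 1 to the orbit count.\<close>
  also have "\<dots> \<le> (\<integral>\<^sup>+g. orbit_count ?Z g \<partial>mu)"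
  proof (rule nn_integral_mono)
    fix g :: "('k,'j) rmat"
    have "emeasure (count_space SLnZ) {mat 1 :: ('k,'j) rmat} \<le> orbit_count ?Z g" if "g \<in> ?Z"
      unfolding orbit_count_def using that SLnZ_one by (intro emeasure_mono) auto
    moreover have "emeasure (count_space SLnZ) {mat 1 :: ('k,'j) rmat} = 1"
      using SLnZ_one by (subst emeasure_count_space) auto
    ultimately show "indicator ?Z g \<le> orbit_count ?Z g"
      by (simp only: indicator_def split: if_split) simp
  qed
  finally show ?thesis using 0 by simp
qed

section \<open>Hitting times\<close>

lemma matrix_inv_unique:
  assumes "g \<in> SLn" "g ** h = mat 1"
  shows "matrix_inv g = h"
proof -
  have "matrix_inv g = matrix_inv g ** (g ** h)" by (simp add: assms(2))
  also have "\<dots> = h" by (simp add: matrix_mul_assoc SLn_inverse[OF assms(1)])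
  finally show ?thesis .
qed

lemma Phi_SLn: "Phi t \<in> SLn"
proof -
  have "det (Phi t :: ('a,'b) rmat) = (\<Prod>c\<in>UNIV. (Phi t :: ('a,'b) rmat) $ c $ c)"
    by (rule det_diagonal) (simp add: Phi_def)
  also have "\<dots> = (\<Prod>c\<in>UNIV <+> UNIV. (Phi t :: ('a,'b) rmat) $ c $ c)" by simp
  also have "\<dots> = 1"
    by (subst prod.Plus) (simp_all add: Phi_def flip: exp_of_nat_mult exp_add)
  finally show ?thesis by (simp add: SLn_def)
qed

lemma vec_Phi: "(v v* Phi t) $ c =
    v $ c * (case c of Inl _ \<Rightarrow> exp (real CARD('j) * t) | Inr _ \<Rightarrow> exp (- real CARD('k) * t))"
  for v :: "('k::finite,'j::finite) rvec"
  by (simp add: vector_matrix_mult_def Phi_def if_distrib[of "\<lambda>u. _ * u"] sum.delta cong: if_cong)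

lemma Phi_mult_minus: "Phi t ** Phi (- t) = mat 1"
  by (auto simp: matrix_matrix_mult_def Phi_def vec_eq_iff mat_def if_distrib[of "\<lambda>u. _ * u"]
      if_distrib[of "\<lambda>u. u * _"] sum.delta simp flip: exp_add split: sum.split cong: if_cong)

lemma phi_conj_SLn: "g0 \<in> SLn \<Longrightarrow> phi_conj g0 t \<in> SLn"
  unfolding phi_conj_def by (intro SLn_mult Phi_SLn SLn_inverse)

lemma matrix_inv_phi_conj:
  assumes g0: "g0 \<in> SLn"
  shows "matrix_inv (phi_conj g0 t) = g0 ** Phi (- t) ** matrix_inv g0"
proof (rule matrix_inv_unique[OF phi_conj_SLn[OF g0]])
  have "phi_conj g0 t ** (g0 ** Phi (- t) ** matrix_inv g0) =
      g0 ** (Phi t ** (matrix_inv g0 ** g0) ** Phi (- t)) ** matrix_inv g0"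
    by (simp add: phi_conj_def matrix_mul_assoc)
  then show "phi_conj g0 t ** (g0 ** Phi (- t) ** matrix_inv g0) = mat 1"
    by (simp add: SLn_inverse[OF g0] Phi_mult_minus)
qed

section \<open>Counting events and admissibility\<close>

lemma primlat_counts_Xsets:
  fixes C :: "nat \<Rightarrow> ('k::finite,'j::finite) rvec set"
  assumes g0: "g0 \<in> SLn" and Cb: "\<forall>i<r. bounded (C i)" and C: "\<forall>i<r. C i \<in> sets borel"
  shows "{g \<in> SLn. \<forall>i<r. card (primlat (g ** g0) \<inter> C i) = N i} \<in> Xsets"
proof -
  let ?e = "\<lambda>i (g :: ('k,'j) rmat).
    emeasure (count_space {w. primitive w}) {w\<in>{w. primitive w}. w v* (g ** g0) \<in> C i}"
  have m: "?e i \<in> borel_measurable borel" if "i < r" for i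
  proof (rule borel_measurable_count[OF countable_primitive])
    have [measurable]: "C i \<in> sets borel" using C that by blast
    show "Measurable.pred borel (\<lambda>g. w v* (g ** g0) \<in> C i)" for w by measurable
  qed
  \<comment> \<open>Boundedness of \<open>C i\<close> matters here: \<open>card\<close> of an
    infinite set is 0 while its counting measure is infinite.\<close>
  have e: "card (primlat (g ** g0) \<inter> C i) = N i \<longleftrightarrow> ?e i g = of_nat (N i)"
    if "g \<in> SLn" "i < r" for g i
  proof -
    have g: "g ** g0 \<in> SLn" using that g0 by (simp add: SLn_mult)
    have "finite {w. primitive w \<and> w v* (g ** g0) \<in> C i}"
      using finite_primlat_Int[OF g, of "C i"] Cb that(2) card_primlat_Int(2)[OF g] by blast
    then have "?e i g = of_nat (card {w. primitive w \<and> w v* (g ** g0) \<in> C i})"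
      by (subst emeasure_count_space) auto
    then show ?thesis unfolding card_primlat_Int(1)[OF g] by simp
  qed
  have "{g \<in> SLn. \<forall>i<r. card (primlat (g ** g0) \<inter> C i) = N i} =
      SLn \<inter> (\<Inter>i\<in>{..<r}. {g \<in> space borel. ?e i g = of_nat (N i)})"
    using e by auto
  moreover have "SLn \<inter> (\<Inter>i\<in>{..<r}. {g \<in> space borel. ?e i g = of_nat (N i)}) \<in> sets borel"
  proof (cases "r = 0")
    case False
    have "{g \<in> space borel. ?e i g = of_nat (N i)} \<in> sets borel" if "i < r" for i
      using m[OF that] by measurable
    then show ?thesis using False by (intro sets.Int SLn_borel sets.finite_INT) auto
  qed auto
  ultimately have borel: "{g \<in> SLn. \<forall>i<r. card (primlat (g ** g0) \<inter> C i) = N i} \<in> sets borel"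
    by simp
  have inv: "primlat (\<gamma> ** g ** g0) = primlat (g ** g0)" if "\<gamma> \<in> SLnZ"
    for \<gamma> g :: "('k,'j) rmat"
    using primlat_SLnZ[OF that, of "g ** g0"] by (simp only: matrix_mul_assoc)
  show ?thesis
    unfolding Xsets_def
  proof (intro CollectI conjI ballI)
    fix \<gamma> g :: "('k,'j) rmat" assume \<gamma>: "\<gamma> \<in> SLnZ"
      and g: "g \<in> {g \<in> SLn. \<forall>i<r. card (primlat (g ** g0) \<inter> C i) = N i}"
    show "\<gamma> ** g \<in> SLn" using g by (intro SLn_mult SLnZ_subset[OF \<gamma>]) blast
    show "\<forall>i<r. card (primlat (\<gamma> ** g ** g0) \<inter> C i) = N i"
      unfolding inv[OF \<gamma>] using g by blast
  qed (use borel in blast)+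
qed

text \<open>If the lattice avoids all the frontiers, every count is constant on a neighbourhood
  \<open>U\<close> of \<open>g\<close>. Within \<open>SLn\<close> the event then contains all of
  \<open>U\<close> or misses it, so \<open>g\<close> cannot be a relative frontier point.\<close>

lemma Xfrontier_counts_subset:
  fixes C :: "nat \<Rightarrow> ('k::finite,'j::finite) rvec set"
  assumes g0: "g0 \<in> SLn" and Cb: "\<forall>i<r. bounded (C i)"
  shows "Xfrontier {g \<in> SLn. \<forall>i<r. card (primlat (g ** g0) \<inter> C i) = N i} \<subseteq>
    {g \<in> SLn. \<exists>i<r. primlat (g ** g0) \<inter> frontier (C i) \<noteq> {}}" (is "Xfrontier ?E \<subseteq> ?Z")
proof
  fix g assume g: "g \<in> Xfrontier ?E"
  then have gS: "g \<in> SLn"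
    using frontier_of_subset_topspace[of "subtopology euclidean SLn" ?E] by (auto simp: Xfrontier_def)
  show "g \<in> ?Z"
  proof (rule ccontr)
    assume "g \<notin> ?Z"
    then have no: "primlat (g ** g0) \<inter> frontier (C i) = {}" if "i < r" for i using gS that by auto
    have gg: "g ** g0 \<in> SLn" using gS g0 by (simp add: SLn_mult)
    have "((\<lambda>h. h ** g0) \<longlongrightarrow> g ** g0) (nhds g)"
      by (rule bounded_bilinear.tendsto[OF bounded_bilinear_matrix_matrix_mult])
         (auto intro: filterlim_ident)
    then have "eventually (\<lambda>h. {w. primitive w \<and> w v* (h ** g0) \<in> C i} =
        {w. primitive w \<and> w v* (g ** g0) \<in> C i}) (nhds g)" if "i < r" for i
      using eventually_nhds_primitive_eq[OF gg _ no[OF that]] Cb that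
      by (blast dest: eventually_compose_filterlim)
    then have "eventually (\<lambda>h. \<forall>i\<in>{..<r}. {w. primitive w \<and> w v* (h ** g0) \<in> C i} =
        {w. primitive w \<and> w v* (g ** g0) \<in> C i}) (nhds g)"
      by (intro eventually_ball_finite) auto
    then obtain U where U: "open U" "g \<in> U"
      "\<And>h i. h \<in> U \<Longrightarrow> i < r \<Longrightarrow> {w. primitive w \<and> w v* (h ** g0) \<in> C i} =
        {w. primitive w \<and> w v* (g ** g0) \<in> C i}"
      by (auto simp: eventually_nhds)
    have same: "h \<in> ?E \<longleftrightarrow> g \<in> ?E" if "h \<in> SLn \<inter> U" for h
      using that gS g0 U(3)[of h] by (simp add: card_primlat_Int(1) SLn_mult)
    have op: "openin (subtopology euclidean SLn) (SLn \<inter> U)"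
      using U(1) by (auto simp: openin_subtopology)
    from g have cl: "g \<in> subtopology euclidean SLn closure_of ?E"
      and ni: "g \<notin> subtopology euclidean SLn interior_of ?E"
      by (auto simp: Xfrontier_def frontier_of_def)
    obtain h where "h \<in> ?E" "h \<in> SLn \<inter> U"
      using cl op U(2) gS by (auto simp: in_closure_of)
    then have "SLn \<inter> U \<subseteq> ?E" using same by blast
    then have "g \<in> subtopology euclidean SLn interior_of ?E"
      using op U(2) gS by (auto simp: interior_of_def)
    then show False using ni by blast
  qed
qed

lemma measure_counts_tendsto:
  fixes mu lam :: "('k::finite,'j::finite) rmat measure"
    and C :: "nat \<Rightarrow> ('k,'j) rvec set"
  assumes mu: "Haar_X mu" and g0: "g0 \<in> SLn" and adm: "admissible mu lam g0"
    and Cb: "\<forall>i<r. bounded (C i)" and C: "\<forall>i<r. C i \<in> sets borel"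
    and Cf: "\<forall>i<r. negligible (frontier (C i))"
  shows "((\<lambda>t. measure lam {g \<in> SLn. \<forall>i<r. card (primlat (g ** g0 ** Phi (- t)) \<inter> C i) = N i})
     \<longlongrightarrow> measure mu {g \<in> SLn. \<forall>i<r. card (primlat g \<inter> C i) = N i}) at_top"
proof -
  note M = Haar_X_D(2,3)[OF mu]
  \<comment> \<open>Building \<open>g0\<close> into the event cancels the trailing inverse of
    \<open>g0\<close> in the inverse of \<open>phi_conj g0 t\<close>, leaving
    \<open>g ** g0 ** Phi (- t)\<close>.\<close>
  let ?E = "{g \<in> SLn. \<forall>i<r. card (primlat (g ** g0) \<inter> C i) = N i}"
  have E: "?E \<in> Xsets" by (rule primlat_counts_Xsets[OF g0 Cb C])
  have "(\<Union>i\<in>{..<r}. {g \<in> SLn. g ** g0 \<in> {g \<in> SLn. primlat g \<inter> frontier (C i) \<noteq> {}}}) \<in> null_sets mu"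
  proof (intro null_sets.finite_UN ballI, goal_cases)
    case (2 i)
    have fb: "frontier (C i) \<in> sets borel" by (intro borel_closed) simp
    let ?Z = "{g \<in> SLn. primlat g \<inter> frontier (C i) \<noteq> {}}"
    have Z: "?Z \<in> Xsets" by (rule primlat_hits_Xsets[OF fb])
    have "{g \<in> SLn. g ** g0 \<in> ?Z} = rtrans ?Z (matrix_inv g0)"
      using SLn_inverse(3)[OF g0] by (subst rtrans_eq) (auto simp: matrix_inv_matrix_inv[OF g0])
    then have "{g \<in> SLn. g ** g0 \<in> ?Z} \<in> Xsets"
      using rtrans_Xsets[OF SLn_inverse(3)[OF g0] Z] by simp
    then show ?case
      using emeasure_Haar_X_translate[OF mu g0 Z] Haar_primlat_null[OF mu _ fb] Cf 2
      by (simp add: null_sets_def M)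
  qed simp
  moreover have "Xfrontier ?E \<subseteq>
      (\<Union>i\<in>{..<r}. {g \<in> SLn. g ** g0 \<in> {g \<in> SLn. primlat g \<inter> frontier (C i) \<noteq> {}}})"
    using Xfrontier_counts_subset[OF g0 Cb, of N] SLn_mult[OF _ g0] by fastforce
  ultimately have "emeasure mu (Xfrontier ?E) = 0"
    by (metis (no_types, lifting) emeasure_mono null_setsD1 null_setsD2 le_zero_eq)
  then have "((\<lambda>t. measure lam (rtrans ?E (phi_conj g0 t))) \<longlongrightarrow> measure mu ?E) at_top"
    using adm E by (simp add: admissible_def)
  moreover have "rtrans ?E (phi_conj g0 t) =
      {g \<in> SLn. \<forall>i<r. card (primlat (g ** g0 ** Phi (- t)) \<inter> C i) = N i}" for t
  proof -
    have "g ** (g0 ** Phi (- t) ** matrix_inv g0) ** g0 = g ** g0 ** Phi (- t)"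
      for g :: "('k,'j) rmat"
      using SLn_cancel_right(2)[OF g0, of "g ** g0 ** Phi (- t)"] by (simp add: matrix_mul_assoc)
    moreover have "g ** (g0 ** Phi (- t) ** matrix_inv g0) \<in> SLn" if "g \<in> SLn" for g
      using that g0 by (intro SLn_mult Phi_SLn SLn_inverse)
    ultimately show ?thesis
      using phi_conj_SLn[OF g0, of t]
      by (subst rtrans_eq) (auto simp: matrix_inv_phi_conj[OF g0])
  qed
  \<comment> \<open>In the limit \<open>g0\<close> disappears because \<open>mu\<close> is right
    invariant.\<close>
  moreover have "measure mu ?E = measure mu {g \<in> SLn. \<forall>i<r. card (primlat g \<inter> C i) = N i}"
  proof -
    have "{g \<in> SLn. \<forall>i<r. card (primlat g \<inter> C i) = N i} \<in> Xsets"
      using primlat_counts_Xsets[OF SLn_one Cb C, of N] by simp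
    then have "emeasure mu {g \<in> SLn. g ** g0 \<in> {g \<in> SLn. \<forall>i<r. card (primlat g \<inter> C i) = N i}} =
        emeasure mu {g \<in> SLn. \<forall>i<r. card (primlat g \<inter> C i) = N i}"
      by (rule emeasure_Haar_X_translate[OF mu g0])
    moreover have "{g \<in> SLn. g ** g0 \<in> {g \<in> SLn. \<forall>i<r. card (primlat g \<inter> C i) = N i}} = ?E"
      using SLn_mult[OF _ g0] by auto
    ultimately show ?thesis by (simp add: measure_def)
  qed
  ultimately show ?thesis by simp
qed

section \<open>Renormalisation of the hitting vectors\<close>

text \<open>With \<open>t = ln L / k\<close>, \<open>Phi (- t)\<close> scales the second block by
  \<open>exp (k t) = L\<close> and the first by \<open>exp (- (m+1) t)\<close>. The quotient
  defining the hitting time is thus scaled by \<open>exp (- n t)\<close>, which is \<open>L\<close>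
  to the power \<open>- n / k\<close>.\<close>

lemma hit_vectors_image:
  fixes g :: "('k::finite,'j::finite) rmat"
  assumes L: "L > 0" and pos: "\<forall>w\<in>W. w $ jn > 0"
  shows "(\<lambda>v. v v* Phi (- (ln L / real CARD('k)))) `
      {v \<in> hit_set jn W g L.
         (L powr (- real (CARD('k) + CARD('j)) / real CARD('k))) *\<^sub>R hit_time jn v \<in> A}
    = primlat (g ** Phi (- (ln L / real CARD('k)))) \<inter> cone jn A W"
proof -
  define t where "t = ln L / real CARD('k)"
  define c where "c = L powr (- real (CARD('k) + CARD('j)) / real CARD('k))"
  have kt: "exp (real CARD('k) * t) = L" using L by (simp add: t_def)
  have c: "c = exp (- real CARD('j) * t - real CARD('k) * t)"
    using L by (simp add: c_def t_def powr_def field_simps)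
  have y: "yjn (v v* Phi (- t)) = L *\<^sub>R yjn v" for v :: "('k,'j) rvec"
    by (simp add: yjn_def vec_eq_iff vec_Phi kt)
  have h: "hit_time jn (v v* Phi (- t)) = c *\<^sub>R hit_time jn v" for v :: "('k,'j) rvec"
    by (simp add: hit_time_def ypr_def vec_eq_iff vec_Phi c exp_diff exp_minus field_simps)
  have W: "yjn v \<in> (\<lambda>w. inverse L *\<^sub>R w) ` W \<longleftrightarrow> L *\<^sub>R yjn v \<in> W" for v :: "('k,'j) rvec"
    using L by (auto intro!: image_eqI[where x = "L *\<^sub>R yjn v"])
  have "v v* Phi (- t) \<in> cone jn A W \<longleftrightarrow> yjn v \<in> (\<lambda>w. inverse L *\<^sub>R w) ` W \<and> c *\<^sub>R hit_time jn v \<in> A"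
    for v :: "('k,'j) rvec"
    by (simp add: mem_cone_iff[OF pos] y h W)
  moreover have "primlat (g ** Phi (- t)) = (\<lambda>v. v v* Phi (- t)) ` primlat g"
    by (auto simp: primlat_def image_def vector_matrix_mul_assoc)
  ultimately show ?thesis
    unfolding hit_set_def t_def[symmetric] c_def[symmetric] by auto
qed

lemma hit_count_eq:
  fixes g :: "('k::finite,'j::finite) rmat"
  assumes "L > 0" "\<forall>w\<in>W. w $ jn > 0"
  shows "hit_count jn W g L A = card (primlat (g ** Phi (- (ln L / real CARD('k)))) \<inter> cone jn A W)"
proof -
  have "inj_on (\<lambda>v. v v* Phi t) S" for t and S :: "('k,'j) rvec set"
    by (auto simp: inj_on_def SLn_vec_inj[OF Phi_SLn])
  then show ?thesis
    unfolding hit_count_def hit_vectors_image[OF assms, symmetric] by (simp only: card_image)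
qed

lemma finite_hit_vectors:
  fixes g :: "('k::finite,'j::finite) rmat"
  assumes g: "g \<in> SLn" and L: "L > 0" and pos: "\<forall>w\<in>W. w $ jn > 0" and bdd: "bounded W" "bounded A"
  shows "finite {v \<in> hit_set jn W g L.
         (L powr (- real (CARD('k) + CARD('j)) / real CARD('k))) *\<^sub>R hit_time jn v \<in> A}"
proof -
  have "finite (primlat (g ** Phi (- (ln L / real CARD('k)))) \<inter> cone jn A W)"
    using g bdd by (intro finite_primlat_Int SLn_mult Phi_SLn bounded_cone)
  then show ?thesis
    unfolding hit_vectors_image[OF L pos, symmetric]
    by (rule finite_imageD) (auto simp: inj_on_def SLn_vec_inj[OF Phi_SLn])
qed

section \<open>Norm balls and the first hitting time\<close>

lemma is_norm_nonneg:
  assumes "is_norm nrm"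
  shows "nrm x \<ge> 0"
proof -
  have "nrm (x + (- 1) *\<^sub>R x) \<le> nrm x + nrm ((- 1) *\<^sub>R x)"
    and "nrm ((- 1) *\<^sub>R x) = \<bar>- 1\<bar> * nrm x" and "nrm 0 = 0"
    using assms unfolding is_norm_def by blast+
  then show ?thesis by simp
qed

text \<open>Convexity is used twice: for continuity of the norm in finite dimension, and for the
  null frontier of its balls.\<close>

lemma is_norm_convex:
  assumes "is_norm nrm"
  shows "convex_on UNIV nrm"
proof (rule convex_onI)
  fix t :: real and x y assume t: "0 < t" "t < 1"
  have "nrm ((1 - t) *\<^sub>R x + t *\<^sub>R y) \<le> nrm ((1 - t) *\<^sub>R x) + nrm (t *\<^sub>R y)"
    using assms unfolding is_norm_def by blast
  also have "\<dots> = \<bar>1 - t\<bar> * nrm x + \<bar>t\<bar> * nrm y"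
    using assms unfolding is_norm_def by metis
  finally show "nrm ((1 - t) *\<^sub>R x + t *\<^sub>R y) \<le> (1 - t) * nrm x + t * nrm y" using t by simp
qed simp

lemma is_norm_continuous:
  assumes "is_norm nrm"
  shows "continuous_on UNIV nrm"
  by (rule convex_on_continuous[OF open_UNIV is_norm_convex[OF assms]])

lemma is_norm_ball:
  assumes n: "is_norm nrm"
  shows "bounded {a. nrm a \<le> X}" "{a. nrm a \<le> X} \<in> sets borel"
    "emeasure lborel (frontier {a. nrm a \<le> X}) = 0"
proof -
  note cont = is_norm_continuous[OF n]
  have "closed {a. nrm a \<le> X}" by (intro closed_Collect_le cont continuous_on_const)
  then show "{a. nrm a \<le> X} \<in> sets borel" by (rule borel_closed)
  have "convex {a. nrm a \<le> X}"
  proof (rule convexI, clarify)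
    fix x y and u v :: real
    assume *: "nrm x \<le> X" "nrm y \<le> X" "0 \<le> u" "0 \<le> v" "u + v = 1"
    have "nrm (u *\<^sub>R x + v *\<^sub>R y) \<le> u * nrm x + v * nrm y"
      using is_norm_convex[OF n] * by (simp add: convex_on_def)
    also have "\<dots> \<le> X" using * by (intro convex_bound_le)
    finally show "nrm (u *\<^sub>R x + v *\<^sub>R y) \<le> X" .
  qed
  then have "frontier {a. nrm a \<le> X} \<in> null_sets lebesgue"
    using negligible_convex_frontier by (simp add: negligible_iff_null_sets)
  then show "emeasure lborel (frontier {a. nrm a \<le> X}) = 0"
    by (subst (asm) null_sets_completion_iff) (auto intro: borel_closed)
  \<comment> \<open>The minimum of \<open>nrm\<close> on the Euclidean unit sphere; its positivity
    bounds the Euclidean norm by a multiple of \<open>nrm\<close>.\<close>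
  obtain x0 where x0: "norm x0 = 1" "\<And>x. norm x = 1 \<Longrightarrow> nrm x0 \<le> nrm x"
  proof -
    have "sphere (0 :: real ^ 'a) 1 \<noteq> {}" by simp
    from continuous_attains_inf[OF compact_sphere this continuous_on_subset[OF cont]]
    show ?thesis using that by auto
  qed
  have "nrm x0 > 0"
  proof -
    have "x0 \<noteq> 0" using x0(1) by auto
    then have "nrm x0 \<noteq> 0" using n by (simp add: is_norm_def)
    then show ?thesis using is_norm_nonneg[OF n, of x0] by simp
  qed
  have "norm a \<le> X / nrm x0" if "nrm a \<le> X" for a
  proof (cases "a = 0")
    case True
    then show ?thesis using is_norm_nonneg[OF n, of a] that \<open>nrm x0 > 0\<close> by simp
  next
    case False
    have "nrm x0 \<le> nrm ((1 / norm a) *\<^sub>R a)" using False by (intro x0) simp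
    also have "\<dots> = nrm a / norm a" using n unfolding is_norm_def by simp
    finally show ?thesis using that False \<open>nrm x0 > 0\<close> by (simp add: field_simps)
  qed
  then show "bounded {a. nrm a \<le> X}" by (auto simp: bounded_iff)
qed

text \<open>A strict bound on each hitting time passes to the infimum because only finitely many
  hitting times lie below any given level.\<close>

lemma xi1_norm_gt_iff:
  fixes g :: "('k::finite,'j::finite) rmat"
  assumes g: "g \<in> SLn" and L: "L > 0" and pos: "\<forall>w\<in>W. w $ jn > 0" and bdd: "bounded W"
    and n: "is_norm nrm"
  shows "ereal (L powr (- real (CARD('k) + CARD('j)) / real CARD('k))) * xi1_norm nrm jn W g L > ereal X
    \<longleftrightarrow> hit_count jn W g L {a. nrm a \<le> X} = 0"
proof -
  define c where "c = L powr (- real (CARD('k) + CARD('j)) / real CARD('k))"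
  have c: "c > 0" using L by (simp add: c_def)
  have cn: "nrm (c *\<^sub>R x) = c * nrm x" for x using n c by (simp add: is_norm_def)
  let ?H = "hit_set jn W g L"
  have fin: "finite {v \<in> ?H. c * nrm (hit_time jn v) \<le> Y}" for Y
    using finite_hit_vectors[OF g L pos bdd is_norm_ball(1)[OF n, of Y]] 
    unfolding c_def[symmetric] by (simp add: cn)
  have "hit_count jn W g L {a. nrm a \<le> X} = 0 \<longleftrightarrow> (\<forall>v\<in>?H. c * nrm (hit_time jn v) > X)"
    unfolding hit_count_def c_def[symmetric] using fin[of X] by (auto simp: cn not_le)
  also have "\<dots> \<longleftrightarrow> ereal c * xi1_norm nrm jn W g L > ereal X"
  proof
    assume X: "\<forall>v\<in>?H. c * nrm (hit_time jn v) > X"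
    \<comment> \<open>The cap \<open>X + 1\<close> keeps the set nonempty even without hits and
      leaves only finitely many values to compare, so \<open>m\<close> is a lower bound strictly
      above \<open>X\<close>.\<close>
    define m where "m = Min (insert (X + 1) ((\<lambda>v. c * nrm (hit_time jn v)) ` {v \<in> ?H. c * nrm (hit_time jn v) \<le> X + 1}))"
    have mX: "m > X" unfolding m_def using fin X by (subst Min_gr_iff) auto
    have "m \<le> c * nrm (hit_time jn v)" if "v \<in> ?H" for v
    proof (cases "c * nrm (hit_time jn v) \<le> X + 1")
      case True
      then show ?thesis unfolding m_def using fin that by (intro Min_le) auto
    next
      case False
      have "m \<le> X + 1" unfolding m_def using fin by (intro Min_le) auto
      then show ?thesis using False by simp
    qed
    then have "ereal (m / c) \<le> xi1_norm nrm jn W g L"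
      unfolding xi1_norm_def using c by (intro Inf_greatest) (auto simp: field_simps)
    then have "ereal c * ereal (m / c) \<le> ereal c * xi1_norm nrm jn W g L"
      using c by (intro ereal_mult_left_mono) auto
    then have "ereal m \<le> ereal c * xi1_norm nrm jn W g L" using c by simp
    then show "ereal c * xi1_norm nrm jn W g L > ereal X"
      using mX less_le_trans[of "ereal X" "ereal m"] by simp
  next
    assume X: "ereal c * xi1_norm nrm jn W g L > ereal X"
    show "\<forall>v\<in>?H. c * nrm (hit_time jn v) > X"
    proof
      fix v assume "v \<in> ?H"
      then have "xi1_norm nrm jn W g L \<le> ereal (nrm (hit_time jn v))"
        unfolding xi1_norm_def by (intro Inf_lower) auto
      then have "ereal c * xi1_norm nrm jn W g L \<le> ereal c * ereal (nrm (hit_time jn v))"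
        using c by (intro ereal_mult_left_mono) auto
      then have "ereal X < ereal c * ereal (nrm (hit_time jn v))" using X by (rule less_le_trans[rotated])
      then show "c * nrm (hit_time jn v) > X" by simp
    qed
  qed
  finally show ?thesis unfolding c_def ..
qed

text \<open>The limit in \<open>t\<close> along the substitution \<open>t = ln L / k\<close>, which
  tends to infinity with \<open>L\<close>.\<close>

lemma hit_count_tendsto:
  fixes mu lam :: "('k::finite,'j::finite) rmat measure"
    and A :: "nat \<Rightarrow> (real ^ 'k) set"
  assumes mu: "Haar_X mu" and g0: "g0 \<in> SLn" and adm: "admissible mu lam g0"
    and W: "bounded W" "W \<in> sets borel" "emeasure lborel (frontier W) = 0" "\<forall>w\<in>W. w $ jn > 0"
    and A: "\<forall>i<r. bounded (A i)" "\<forall>i<r. A i \<in> sets borel"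
      "\<forall>i<r. emeasure lborel (frontier (A i)) = 0"
  shows "((\<lambda>L. measure lam {g \<in> SLn. \<forall>i<r. hit_count jn W (g ** g0) L (A i) = N i})
            \<longlongrightarrow> measure mu {g \<in> SLn. \<forall>i<r. card (primlat g \<inter> cone jn (A i) W) = N i}) at_top"
proof -
  have lim: "((\<lambda>t. measure lam {g \<in> SLn. \<forall>i<r. card (primlat (g ** g0 ** Phi (- t)) \<inter> cone jn (A i) W) = N i})
     \<longlongrightarrow> measure mu {g \<in> SLn. \<forall>i<r. card (primlat g \<inter> cone jn (A i) W) = N i}) at_top"
    using W A by (intro measure_counts_tendsto[OF mu g0 adm])
      (auto intro: bounded_cone cone_borel negligible_frontier_cone)
  have "filterlim (\<lambda>L. ln L * (1 / real CARD('k))) at_top at_top"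
    by (rule filterlim_at_top_mult_tendsto_pos[OF tendsto_const _ ln_at_top]) simp
  then have "filterlim (\<lambda>L. ln L / real CARD('k)) at_top at_top" by simp
  note lim' = filterlim_compose[OF lim this]
  have "eventually (\<lambda>L::real. L > 0) at_top" by (rule eventually_gt_at_top)
  then have "eventually (\<lambda>L. measure lam {g \<in> SLn. \<forall>i<r. card (primlat (g ** g0 ** Phi (- (ln L / real CARD('k))))
        \<inter> cone jn (A i) W) = N i} =
      measure lam {g \<in> SLn. \<forall>i<r. hit_count jn W (g ** g0) L (A i) = N i}) at_top"
    by eventually_elim (simp add: hit_count_eq[OF _ W(4)])
  then show ?thesis by (rule Lim_transform_eventually[OF lim'])
qed

theorem theorem7:
  fixes mu lam :: "('k::finite,'j::finite) rmat measure"
    and g0 :: "('k,'j) rmat" and jn :: 'j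
    and nrm :: "real ^ 'k \<Rightarrow> real"
    and W :: "(real ^ 'j) set"
    and r :: nat and A :: "nat \<Rightarrow> (real ^ 'k) set" and N :: "nat \<Rightarrow> nat"
  assumes mu: "Haar_X mu"
    and g0: "g0 \<in> SLn"
    and lam: "Xprob lam"
    and adm: "admissible mu lam g0"
    and nrm: "is_norm nrm"
    and W_bdd: "bounded W" and W_borel: "W \<in> sets borel"
    and W_int: "interior W \<noteq> {}"
    and W_front: "emeasure lborel (frontier W) = 0"
    and W_pos: "\<forall>w\<in>W. w $ jn > 0"
    and A_bdd: "\<forall>i<r. bounded (A i)" and A_borel: "\<forall>i<r. A i \<in> sets borel"
    and A_front: "\<forall>i<r. emeasure lborel (frontier (A i)) = 0"
  shows "((\<lambda>L. measure lam {g \<in> SLn. \<forall>i<r. hit_count jn W (g ** g0) L (A i) = N i})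
            \<longlongrightarrow> measure mu {g \<in> SLn. \<forall>i<r. card (primlat g \<inter> cone jn (A i) W) = N i}) at_top
         \<and> (\<forall>X>0. ((\<lambda>L. measure lam {g \<in> SLn.
                   ereal (L powr (- real (CARD('k) + CARD('j)) / real CARD('k)))
                     * xi1_norm nrm jn W (g ** g0) L > ereal X})
            \<longlongrightarrow> measure mu {g \<in> SLn. primlat g \<inter> cone jn {a. nrm a \<le> X} W = {}}) at_top)"
proof (intro conjI allI impI)
  note tendsto = hit_count_tendsto[OF mu g0 adm W_bdd W_borel W_front W_pos]
  show "((\<lambda>L. measure lam {g \<in> SLn. \<forall>i<r. hit_count jn W (g ** g0) L (A i) = N i})
            \<longlongrightarrow> measure mu {g \<in> SLn. \<forall>i<r. card (primlat g \<inter> cone jn (A i) W) = N i}) at_top"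
    by (rule tendsto[OF A_bdd A_borel A_front])
  fix X :: real assume "X > 0"
  let ?B = "{a. nrm a \<le> X}"
  \<comment> \<open>The void probability is the case of one test set, the norm ball, with prescribed
    count 0.\<close>
  have "((\<lambda>L. measure lam {g \<in> SLn. \<forall>i<Suc 0. hit_count jn W (g ** g0) L ?B = 0})
            \<longlongrightarrow> measure mu {g \<in> SLn. \<forall>i<Suc 0. card (primlat g \<inter> cone jn ?B W) = 0}) at_top"
    using is_norm_ball[OF nrm, of X] by (intro tendsto) auto
  then have lim: "((\<lambda>L. measure lam {g \<in> SLn. hit_count jn W (g ** g0) L ?B = 0})
            \<longlongrightarrow> measure mu {g \<in> SLn. card (primlat g \<inter> cone jn ?B W) = 0}) at_top"
    by simp
  \<comment> \<open>Finiteness of the intersection rules out the default value 0 of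
    \<open>card\<close> on infinite sets.\<close>
  have "{g \<in> SLn. card (primlat g \<inter> cone jn ?B W) = 0} = {g \<in> SLn. primlat g \<inter> cone jn ?B W = {}}"
    using finite_primlat_Int[OF _ bounded_cone[OF is_norm_ball(1)[OF nrm, of X] W_bdd]] by auto
  note lim = lim[unfolded this]
  have "eventually (\<lambda>L::real. L > 0) at_top" by (rule eventually_gt_at_top)
  then have "eventually (\<lambda>L. measure lam {g \<in> SLn. hit_count jn W (g ** g0) L ?B = 0} =
     measure lam {g \<in> SLn. ereal (L powr (- real (CARD('k) + CARD('j)) / real CARD('k)))
                     * xi1_norm nrm jn W (g ** g0) L > ereal X}) at_top"
  proof eventually_elim
    case (elim L)
    have "{g \<in> SLn. hit_count jn W (g ** g0) L ?B = 0} =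
      {g \<in> SLn. ereal (L powr (- real (CARD('k) + CARD('j)) / real CARD('k)))
                     * xi1_norm nrm jn W (g ** g0) L > ereal X}"
      using xi1_norm_gt_iff[OF SLn_mult[OF _ g0] elim W_pos W_bdd nrm] by blast
    then show ?case by (rule arg_cong)
  qed
  then show "((\<lambda>L. measure lam {g \<in> SLn.
                   ereal (L powr (- real (CARD('k) + CARD('j)) / real CARD('k)))
                     * xi1_norm nrm jn W (g ** g0) L > ereal X})
            \<longlongrightarrow> measure mu {g \<in> SLn. primlat g \<inter> cone jn ?B W = {}}) at_top"
    by (rule Lim_transform_eventually[OF lim])
qed

end
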